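(* Let $n,\kappa\ge 1$ be integers, let $A\in\mathbb R^{n\times n}$ be symmetric with a factorization $A=L_0\Omega_0L_0^T$, where $\Omega_0$ is a diagonal signature matrix and $L_0$ is lower triangular, and suppose that $L_0^T$ is upper quasiseparable of order $\kappa$ with upper generators $g_i\in\mathbb R^\kappa$ ($1\le i\le n-1$), $h_j\in\mathbb R^\kappa$ ($2\le j\le n$), $B_\ell\in\mathbb R^{\kappa\times\kappa}$ ($2\le \ell\le n-1$). Let $\alpha\in\mathbb R$ and $A_\alpha=A+\alpha I_n$. Whenever the zeroing scheme described in the context, applied to these data, goes to completion, it computes vectors $s_i$ ($1\le i\le n$), vectors $z_i\in\mathbb R^\kappa$ ($1\le i\le n-\kappa-1$) and a diagonal signature matrix $\Omega_\alpha\in\mathbb R^{n\times n}$ such that $$A_\alpha=L_\alpha\Omega_\alpha L_\alpha^T,$$ where $L_\alpha^T\in\mathbb R^{n\times n}$ is the upper triangular matrix with entries $$(L_\alpha^T)_{i,j}=\begin{cases}0 & \text{if } i>j,\\ (s_i)_{j-i+1} & \text{if } i\le j\le i+\kappa,\ j\le n,\\ z_i^T B_{\kappa+i+1}\cdots B_{j-1}h_j & \text{if } i+\kappa<j\le n,\end{cases}$$ the product $B_{\kappa+i+1}\cdots B_{j-1}$ being $I_\kappa$ when $j=i+\kappa+1$.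
   Context: **Signature matrix and generators.** A (diagonal) signature matrix is a diagonal matrix with diagonal entries in $\{1,-1\}$. That the upper triangular matrix $L_0^T$ is upper quasiseparable of order $\kappa$ with upper generators $g_i,h_j,B_\ell$ means $(L_0^T)_{i,j}=g_i^T B_{i+1}\cdots B_{j-1}h_j$ for $i<j$ (empty product $=I_\kappa$); the diagonal entries of $L_0^T$ are arbitrary. For a matrix $M$, $M([k,m],:)$ denotes the submatrix of rows $k$ and $m$, and similarly for $M([k,m],[k,m])$. $\oplus$ is the block-diagonal sum. **Plane rotations.** Let $\mathcal J_2=\begin{bmatrix} 0 & 1 \\ 1 & 0 \end{bmatrix}$. For $(x_1,x_2)\ne(0,0)$ with $|x_1|\ge|x_2|$ put $\rho=x_2/x_1$ and $\mathrm{giv}(x_1,x_2)=\frac1{\sqrt{1+\rho^2}}\begin{bmatrix} 1 & \rho \\ -\rho & 1 \end{bmatrix}$; for $|x_1|<|x_2|$ put $\mathrm{giv}(x_1,x_2)=\mathrm{giv}(x_2,x_1)\mathcal J_2$. For $|x_1|>|x_2|$ put $\rho=x_2/x_1$ and $\mathrm{hypf}(x_1,x_2)=\frac1{\sqrt{1-\rho^2}}\begin{bmatrix} 1 & -\rho \\ -\rho & 1 \end{bmatrix}$; for $|x_1|<|x_2|$ put $\mathrm{hypf}(x_1,x_2)=\mathrm{hypf}(x_2,x_1)\mathcal J_2$. $\mathrm{hypf}(x_1,x_2)$ is undefined if $|x_1|=|x_2|$, and $\mathrm{giv}(0,0)$ is undefined. When defined, these matrices map $[x_1,x_2]^T$ to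 a vector of the form $[y,0]^T$. **Procedure ZEROING$(R,\Omega,k,j)$** ($R\in\mathbb R^{2n\times n}$, $\Omega\in\mathbb R^{2n\times 2n}$ a signature matrix, $1\le k,j\le n$). Let $x_1=R(k,j)$, $x_2=R(n+j,j)$. - If $\Omega(k,k)=\Omega(n+j,n+j)$, let $\mathcal U=\mathrm{giv}(x_1,x_2)$; otherwise let $\mathcal U=\mathrm{hypf}(x_1,x_2)$. - Replace $R([k,n+j],:)$ by $\mathcal J_2\,\mathcal U\,R([k,n+j],:)$ (this makes the $(k,j)$ entry of $R$ zero). - If $\Omega(k,k)\neq\Omega(n+j,n+j)$ and $|x_1|>|x_2|$, also replace $\Omega([k,n+j],[k,n+j])$ by $\mathcal J_2\,\Omega([k,n+j],[k,n+j])\,\mathcal J_2$; in all other cases $\Omega$ is unchanged. The procedure returns the modified $R$ and $\Omega$; it breaks down if the required $\mathcal U$ is undefined. **The zeroing scheme.** Initialize $$R_0=\begin{bmatrix} L_0^T \\ \sqrt{|\alpha|}\,I_n \end{bmatrix}\in\mathbb R^{2n\times n},\qquad \widehat\Omega_0=\Omega_0\oplus(\pm I_n),$$ with sign $+$ if $\alpha\ge0$ and $-$ if $\alpha<0$, so that $A_\alpha=R_0^T\widehat\Omega_0R_0$. If $n\ge\kappa+2$, let $\widehat X_1\in\mathbb R^{\kappa\times\kappa}$ be the matrix whose $i$-th row is $g_i^TB_{i+1}\cdots B_\kappa$ ($1\le i\le\kappa$; the last row is $g_\kappa^T$). For $\ell=1,2,\dots,n$ do the following. 1. (Only if $\ell\le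 n-\kappa-1$.) Form $G_\ell=\begin{bmatrix} \widehat X_\ell B_{\kappa+\ell} \\ g_{\kappa+\ell}^T \end{bmatrix}\in\mathbb R^{(\kappa+1)\times\kappa}$ and compute a generalized QL factorization $H_\ell G_\ell=\begin{bmatrix} 0^T \\ X_\ell \end{bmatrix}$ with $X_\ell\in\mathbb R^{\kappa\times\kappa}$ lower triangular. Here $H_\ell\in\mathbb R^{(\kappa+1)\times(\kappa+1)}$ is a product of Givens/hyperbolic plane rotations (possibly combined with interchanges of the two coordinates), chosen according to the signature so that, with $\widehat H_\ell=I_{\ell-1}\oplus H_\ell\oplus I_{2n-\ell-\kappa}$, the matrix $\widehat\Omega_{\ell-1/2}:=\widehat H_\ell\widehat\Omega_{\ell-1}\widehat H_\ell^T$ is again a diagonal signature matrix. 2. Set $R_{\ell-1/2}=\widehat H_\ell R_{\ell-1}$. (If $\ell\ge n-\kappa$, steps 1 and 2 are replaced by $R_{\ell-1/2}=R_{\ell-1}$, $\widehat\Omega_{\ell-1/2}=\widehat\Omega_{\ell-1}$.) 3. For $k=\max(1,\ell-\kappa),\dots,\ell$ in increasing order, replace $(R_{\ell-1/2},\widehat\Omega_{\ell-1/2})$ by the output of ZEROING$(R_{\ell-1/2},\widehat\Omega_{\ell-1/2},k,\ell)$. 4. For $k=\ell+1,\dots,\min(n,\ell+\kappa)$ in increasing order, replace $(R_{\ell-1/2},\widehat\Omega_{\ell-1/2})$ by the output of ZEROING$(R_{\ell-1/2},\widehat\Omega_{\ell-1/2},k,\ell)$. If $\ell\le n-\kappa-1$,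 apply in parallel the same $2\times2$ transformations $\mathcal J_2\,\mathcal U$ to the $(\kappa+1)\times\kappa$ matrix $\begin{bmatrix} X_\ell \\ 0^T \end{bmatrix}$, where its $m$-th row ($1\le m\le\kappa$) corresponds to row $\ell+m$ of $R_{\ell-1/2}$ and its last row to row $n+\ell$; the result is $\begin{bmatrix} \widehat X_{\ell+1} \\ z_\ell^T \end{bmatrix}$, which defines $\widehat X_{\ell+1}\in\mathbb R^{\kappa\times\kappa}$ and $z_\ell\in\mathbb R^\kappa$. 5. Set $R_\ell=R_{\ell-1/2}$, $\widehat\Omega_\ell=\widehat\Omega_{\ell-1/2}$, and let $s_\ell$ be the vector of entries of row $n+\ell$ of $R_\ell$ in columns $\ell,\ell+1,\dots,\min(n,\ell+\kappa)$. At the end put $\Omega_\alpha=\widehat\Omega_n(n+1:2n,\,n+1:2n)$. The scheme **goes to completion** if all factorizations in step 1 exist and are carried out, and no call of ZEROING breaks down. *)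

theory Defs
  imports Complex_Main "Jordan_Normal_Form.Matrix"
begin

text \<open>Row, column, generator and stage numbers below are 1-based, as usual in linear algebra,
  whereas \<open>$$\<close> and \<open>$\<close> are 0-based; the shift is confined to the following
  definitions. \<open>put_rows2\<close> and \<open>put_minor2\<close> are meant for \<open>k \<noteq> m\<close>.\<close>

definition entry :: "real mat \<Rightarrow> nat \<Rightarrow> nat \<Rightarrow> real" where
  "entry M i j = M $$ (i - 1, j - 1)"

definition rows2 :: "nat \<Rightarrow> nat \<Rightarrow> real mat \<Rightarrow> real mat" where
  "rows2 k m M = mat_of_rows (dim_col M) [row M (k - 1), row M (m - 1)]"

definition put_rows2 :: "nat \<Rightarrow> nat \<Rightarrow> real mat \<Rightarrow> real mat \<Rightarrow> real mat" where
  "put_rows2 k m S M = mat (dim_row M) (dim_col M)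
     (\<lambda>(i, j). if i = k - 1 then S $$ (0, j) else if i = m - 1 then S $$ (1, j) else M $$ (i, j))"

definition minor2 :: "nat \<Rightarrow> nat \<Rightarrow> real mat \<Rightarrow> real mat" where
  "minor2 k m M =
     mat_of_rows_list 2 [[entry M k k, entry M k m], [entry M m k, entry M m m]]"

definition put_minor2 :: "nat \<Rightarrow> nat \<Rightarrow> real mat \<Rightarrow> real mat \<Rightarrow> real mat" where
  "put_minor2 k m S M = mat (dim_row M) (dim_col M)
     (\<lambda>(i, j). if i \<in> {k - 1, m - 1} \<and> j \<in> {k - 1, m - 1}
        then S $$ (if i = k - 1 then 0 else 1, if j = k - 1 then 0 else 1)
        else M $$ (i, j))"

definition lower_triangular :: "real mat \<Rightarrow> bool" where
  "lower_triangular M \<longleftrightarrow> (\<forall>i<dim_row M. \<forall>j<dim_col M. i < j \<longrightarrow> M $$ (i, j) = 0)"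

definition signature_mat :: "nat \<Rightarrow> real mat \<Rightarrow> bool" where
  "signature_mat N W \<longleftrightarrow>
     W \<in> carrier_mat N N \<and> diagonal_mat W \<and> (\<forall>i<N. W $$ (i, i) \<in> {1, -1})"

text \<open>The ordered product \<open>B\<^sub>a B\<^sub>a\<^sub>+\<^sub>1 \<dots> B\<^sub>b\<^sub>-\<^sub>1\<close> (half-open range); it is the identity if \<open>b \<le> a\<close>.\<close>

definition prod_range :: "nat \<Rightarrow> (nat \<Rightarrow> real mat) \<Rightarrow> nat \<Rightarrow> nat \<Rightarrow> real mat" where
  "prod_range \<kappa> B a b = foldr (*) (map B [a..<b]) (1\<^sub>m \<kappa>)"

definition upper_quasiseparable ::
  "nat \<Rightarrow> nat \<Rightarrow> real mat \<Rightarrow> (nat \<Rightarrow> real vec) \<Rightarrow> (nat \<Rightarrow> real vec) \<Rightarrow> (nat \<Rightarrow> real mat) \<Rightarrow> bool" where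
  "upper_quasiseparable n \<kappa> M g h B \<longleftrightarrow>
     M \<in> carrier_mat n n \<and>
     (\<forall>i. 1 \<le> i \<and> i \<le> n - 1 \<longrightarrow> g i \<in> carrier_vec \<kappa>) \<and>
     (\<forall>j. 2 \<le> j \<and> j \<le> n \<longrightarrow> h j \<in> carrier_vec \<kappa>) \<and>
     (\<forall>l. 2 \<le> l \<and> l \<le> n - 1 \<longrightarrow> B l \<in> carrier_mat \<kappa> \<kappa>) \<and>
     (\<forall>i j. 1 \<le> i \<and> i < j \<and> j \<le> n \<longrightarrow>
        entry M i j = g i \<bullet> (prod_range \<kappa> B (i + 1) j *\<^sub>v h j))"

definition J2 :: "real mat" where
  "J2 = mat_of_rows_list 2 [[0, 1], [1, 0]]"

definition givens_mat :: "real \<Rightarrow> real mat" where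
  "givens_mat \<rho> = (1 / sqrt (1 + \<rho>\<^sup>2)) \<cdot>\<^sub>m mat_of_rows_list 2 [[1, \<rho>], [- \<rho>, 1]]"

definition hyperbolic_mat :: "real \<Rightarrow> real mat" where
  "hyperbolic_mat \<rho> = (1 / sqrt (1 - \<rho>\<^sup>2)) \<cdot>\<^sub>m mat_of_rows_list 2 [[1, - \<rho>], [- \<rho>, 1]]"

text \<open>\<open>None\<close> stands for ``undefined''.\<close>

definition giv :: "real \<Rightarrow> real \<Rightarrow> real mat option" where
  "giv x1 x2 =
     (if x1 = 0 \<and> x2 = 0 then None
      else if \<bar>x1\<bar> \<ge> \<bar>x2\<bar> then Some (givens_mat (x2 / x1))
      else Some (givens_mat (x1 / x2) * J2))"

definition hypf :: "real \<Rightarrow> real \<Rightarrow> real mat option" where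
  "hypf x1 x2 =
     (if \<bar>x1\<bar> = \<bar>x2\<bar> then None
      else if \<bar>x1\<bar> > \<bar>x2\<bar> then Some (hyperbolic_mat (x2 / x1))
      else Some (hyperbolic_mat (x1 / x2) * J2))"

text \<open>Products of \<open>N \<times> N\<close> plane transformations, each acting in a coordinate plane
  \<open>(p, q)\<close> as a Givens rotation, a hyperbolic rotation or an interchange.
  Which kind may be used where is not prescribed here; compatibility with the signature
  is imposed on the whole product in \<open>full_stage\<close>.\<close>

inductive plane_product :: "nat \<Rightarrow> real mat \<Rightarrow> bool" for N where
  plane_product_one: "plane_product N (1\<^sub>m N)"
| plane_product_step:
    "\<lbrakk>plane_product N H; p \<in> {1..N}; q \<in> {1..N}; p \<noteq> q;
      giv x1 x2 = Some U \<or> hypf x1 x2 = Some U \<or> U = J2\<rbrakk>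
     \<Longrightarrow> plane_product N (put_minor2 p q U (1\<^sub>m N) * H)"

text \<open>The matrix \<open>\<U>\<close> used by one call of the zeroing procedure, and the
  replacement of two rows by \<open>J2 * \<U>\<close> times these rows.\<close>

definition zeroing_U :: "nat \<Rightarrow> real mat \<Rightarrow> real mat \<Rightarrow> nat \<Rightarrow> nat \<Rightarrow> real mat option" where
  "zeroing_U n R W k j =
     (if entry W k k = entry W (n + j) (n + j)
      then giv (entry R k j) (entry R (n + j) j)
      else hypf (entry R k j) (entry R (n + j) j))"

definition transform_rows :: "real mat \<Rightarrow> nat \<Rightarrow> nat \<Rightarrow> real mat \<Rightarrow> real mat" where
  "transform_rows U k m M = put_rows2 k m (J2 * U * rows2 k m M) M"

definition zeroing ::
  "nat \<Rightarrow> nat \<Rightarrow> nat \<Rightarrow> real mat \<times> real mat \<Rightarrow> (real mat \<times> real mat) option" where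
  "zeroing n j k = (\<lambda>(R, W).
     map_option
       (\<lambda>U. (transform_rows U k (n + j) R,
             if entry W k k \<noteq> entry W (n + j) (n + j) \<and> \<bar>entry R k j\<bar> > \<bar>entry R (n + j) j\<bar>
             then put_minor2 k (n + j) (J2 * minor2 k (n + j) W * J2) W
             else W))
       (zeroing_U n R W k j))"

text \<open>Zeroing of column \<open>j\<close> with the same transformations applied in parallel to the
  \<open>(\<kappa> + 1)\<close>-rowed matrix \<open>Y\<close>: row \<open>k\<close> of \<open>R\<close> corresponds to row \<open>k - j\<close> of \<open>Y\<close>, and row
  \<open>n + j\<close> of \<open>R\<close> to the last row of \<open>Y\<close>.\<close>

definition zeroing_par ::
  "nat \<Rightarrow> nat \<Rightarrow> nat \<Rightarrow> nat \<Rightarrow> (real mat \<times> real mat) \<times> real mat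
     \<Rightarrow> ((real mat \<times> real mat) \<times> real mat) option" where
  "zeroing_par n \<kappa> j k = (\<lambda>((R, W), Y).
     Option.bind (zeroing n j k (R, W)) (\<lambda>RW.
     map_option (\<lambda>U. (RW, transform_rows U (k - j) (\<kappa> + 1) Y)) (zeroing_U n R W k j)))"

fun iterate :: "('i \<Rightarrow> 's \<Rightarrow> 's option) \<Rightarrow> 'i list \<Rightarrow> 's \<Rightarrow> 's option" where
  "iterate f [] st = Some st"
| "iterate f (k # ks) st = Option.bind (f k st) (iterate f ks)"

text \<open>Stage \<open>l \<le> n - \<kappa> - 1\<close>, from \<open>R\<^sub>l\<^sub>-\<^sub>1\<close>, \<open>W\<^sub>l\<^sub>-\<^sub>1\<close>, \<open>Xh\<^sub>l\<close> to \<open>R\<^sub>l\<close>, \<open>W\<^sub>l\<close>, \<open>Xh\<^sub>l\<^sub>+\<^sub>1\<close>, \<open>z\<^sub>l\<close>.\<close>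

definition full_stage ::
  "nat \<Rightarrow> nat \<Rightarrow> (nat \<Rightarrow> real vec) \<Rightarrow> (nat \<Rightarrow> real mat) \<Rightarrow> nat \<Rightarrow>
   real mat \<Rightarrow> real mat \<Rightarrow> real mat \<Rightarrow> real mat \<Rightarrow> real mat \<Rightarrow> real mat \<Rightarrow> real vec \<Rightarrow> bool" where
  "full_stage n \<kappa> g B l R W Xh R' W' Xh' z \<longleftrightarrow>
     (\<exists>G H X Hh Wh RW Y.
        G = (Xh * B (\<kappa> + l)) @\<^sub>r mat_of_row (g (\<kappa> + l)) \<and>
        plane_product (\<kappa> + 1) H \<and>
        X \<in> carrier_mat \<kappa> \<kappa> \<and> lower_triangular X \<and>
        H * G = mat_of_row (0\<^sub>v \<kappa>) @\<^sub>r X \<and>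
        Hh = diag_block_mat [1\<^sub>m (l - 1), H, 1\<^sub>m (2 * n - l - \<kappa>)] \<and>
        Wh = Hh * W * transpose_mat Hh \<and> signature_mat (2 * n) Wh \<and>
        iterate (zeroing n l) [max 1 (l - \<kappa>)..<l + 1] (Hh * R, Wh) = Some RW \<and>
        iterate (zeroing_par n \<kappa> l) [l + 1..<min n (l + \<kappa>) + 1]
          (RW, X @\<^sub>r mat_of_row (0\<^sub>v \<kappa>)) = Some ((R', W'), Y) \<and>
        Xh' = mat_of_rows \<kappa> (map (row Y) [0..<\<kappa>]) \<and>
        z = row Y \<kappa>)"

definition tail_stage ::
  "nat \<Rightarrow> nat \<Rightarrow> nat \<Rightarrow> real mat \<Rightarrow> real mat \<Rightarrow> real mat \<Rightarrow> real mat \<Rightarrow> bool" where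
  "tail_stage n \<kappa> l R W R' W' \<longleftrightarrow>
     (\<exists>RW.
        iterate (zeroing n l) [max 1 (l - \<kappa>)..<l + 1] (R, W) = Some RW \<and>
        iterate (zeroing n l) [l + 1..<min n (l + \<kappa>) + 1] RW = Some (R', W'))"

text \<open>The scheme goes to completion, for some admissible choice of the factorizations, and
  returns \<open>s\<close>, \<open>z\<close> and \<open>\<Omega>\<^sub>\<alpha>\<close>. It is a relation because the factorizations are not unique.
  Nothing is said about \<open>s l\<close> for \<open>l \<notin> {1..n}\<close> or \<open>z l\<close> for \<open>l \<notin> {1..n - \<kappa> - 1}\<close>.\<close>

definition zeroing_scheme ::
  "nat \<Rightarrow> nat \<Rightarrow> real mat \<Rightarrow> real mat \<Rightarrow> (nat \<Rightarrow> real vec) \<Rightarrow> (nat \<Rightarrow> real mat) \<Rightarrow> real \<Rightarrow>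
   (nat \<Rightarrow> real vec) \<Rightarrow> (nat \<Rightarrow> real vec) \<Rightarrow> real mat \<Rightarrow> bool" where
  "zeroing_scheme n \<kappa> L0 \<Omega>0 g B \<alpha> s z \<Omega>\<alpha> \<longleftrightarrow>
     (\<exists>R W Xh :: nat \<Rightarrow> real mat.
        R 0 = transpose_mat L0 @\<^sub>r (sqrt \<bar>\<alpha>\<bar> \<cdot>\<^sub>m 1\<^sub>m n) \<and>
        W 0 = diag_block_mat [\<Omega>0, if \<alpha> \<ge> 0 then 1\<^sub>m n else - 1\<^sub>m n] \<and>
        (n \<ge> \<kappa> + 2 \<longrightarrow>
          Xh 1 = mat_of_rows \<kappa>
            (map (\<lambda>i. transpose_mat (prod_range \<kappa> B (i + 1) (\<kappa> + 1)) *\<^sub>v g i) [1..<\<kappa> + 1])) \<and>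
        (\<forall>l\<in>{1..n}.
          (if l + \<kappa> + 1 \<le> n
           then full_stage n \<kappa> g B l (R (l - 1)) (W (l - 1)) (Xh l) (R l) (W l) (Xh (l + 1)) (z l)
           else tail_stage n \<kappa> l (R (l - 1)) (W (l - 1)) (R l) (W l)) \<and>
          s l = vec (min n (l + \<kappa>) + 1 - l) (\<lambda>t. entry (R l) (n + l) (l + t))) \<and>
        \<Omega>\<alpha> = mat n n (\<lambda>(i, j). W n $$ (n + i, n + j)))"

definition L_alpha_T ::
  "nat \<Rightarrow> nat \<Rightarrow> (nat \<Rightarrow> real vec) \<Rightarrow> (nat \<Rightarrow> real vec) \<Rightarrow> (nat \<Rightarrow> real vec) \<Rightarrow> (nat \<Rightarrow> real mat)
   \<Rightarrow> real mat" where
  "L_alpha_T n \<kappa> s z h B = mat n n (\<lambda>(a, b). let i = a + 1; j = b + 1 in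
     if i > j then 0
     else if j \<le> i + \<kappa> then s i $ (j - i)
     else z i \<bullet> (prod_range \<kappa> B (\<kappa> + i + 1) j *\<^sub>v h j))"

end

theory Submission
  imports Defs "Jordan_Normal_Form.Determinant"
begin

text \<open>Every transformation preserves \<open>R\<^sup>T W R\<close>, which is \<open>A + \<alpha> I\<close> at the start. After stage \<open>l\<close>
  the first \<open>l\<close> columns of the upper half of \<open>R\<close> vanish, so at the end only the lower half remains.
  What has to be tracked is the shape of row \<open>n + l\<close> when it is frozen. The QL step annihilates the
  generator of row \<open>l\<close>, so that this row has no entries beyond column \<open>l + \<kappa>\<close>; hence the
  zeroing of column \<open>l\<close> involves only the rows \<open>l - \<kappa>, \<dots>, l + \<kappa>\<close>, and treating the rows up to
  \<open>l\<close> creates nothing beyond column \<open>l + \<kappa>\<close>. The next \<open>\<kappa>\<close> rows are, beyond column \<open>l + \<kappa>\<close>,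
  the rows of \<open>X\<^sub>l\<close> times the vectors \<open>B\<^sub>l\<^sub>+\<^sub>\<kappa>\<^sub>+\<^sub>1 \<dots> B\<^sub>j\<^sub>-\<^sub>1 h\<^sub>j\<close>, and the parallel updates turn
  the last row of \<open>[X\<^sub>l; 0]\<close> into a generator of row \<open>n + l\<close>.\<close>

section \<open>Invariants of partial iterations, and matrix products as sums\<close>

lemma iterate_upt_invariant:
  assumes "iterate f [a..<b] st = Some st'" and "P a st" and "a \<le> b"
    and "\<And>k st st'. a \<le> k \<Longrightarrow> k < b \<Longrightarrow> P k st \<Longrightarrow> f k st = Some st' \<Longrightarrow> P (Suc k) st'"
  shows "P b st'"
  using assms
proof (induction "b - a" arbitrary: a st)
  case 0
  then show ?case by simp
next
  case (Suc d)
  then have ab: "a < b" by simp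
  then have "[a..<b] = a # [Suc a..<b]" by (rule upt_conv_Cons)
  with Suc.prems(1) obtain st1 where st1: "f a st = Some st1" "iterate f [Suc a..<b] st1 = Some st'"
    by (auto simp: bind_eq_Some_conv)
  have "P (Suc a) st1"
    using Suc.prems(4)[OF _ ab Suc.prems(2) st1(1)] by simp
  then show ?case
    using Suc.hyps(1)[of "Suc a" st1] Suc.hyps(2) st1(2) ab Suc.prems(4) by simp
qed

lemma index_mult_mat_sum:
  assumes "A \<in> carrier_mat r N" "B \<in> carrier_mat N c" "i < r" "j < c"
  shows "(A * B) $$ (i, j) = (\<Sum>q<N. A $$ (i, q) * B $$ (q, j))"
  using assms by (auto simp: scalar_prod_def lessThan_atLeast0)

subsection \<open>Congruence with signature matrices\<close>

definition gram :: "real mat \<Rightarrow> real mat \<Rightarrow> real mat" where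
  "gram R W = transpose_mat R * W * R"

lemma gram_carrier: "R \<in> carrier_mat N n \<Longrightarrow> W \<in> carrier_mat N N \<Longrightarrow> gram R W \<in> carrier_mat n n"
  by (auto simp: gram_def)

lemma gram_signature_index:
  assumes "R \<in> carrier_mat N n" "signature_mat N W" "i < n" "j < n"
  shows "gram R W $$ (i, j) = (\<Sum>p<N. W $$ (p, p) * R $$ (p, i) * R $$ (p, j))"
proof -
  have W: "W \<in> carrier_mat N N" "\<And>p q. p < N \<Longrightarrow> q < N \<Longrightarrow> p \<noteq> q \<Longrightarrow> W $$ (p, q) = 0"
    using assms(2) by (auto simp: signature_mat_def diagonal_mat_def)
  have WR: "(W * R) $$ (p, j) = W $$ (p, p) * R $$ (p, j)" if "p < N" for p
  proof -
    have "(W * R) $$ (p, j) = (\<Sum>q = 0..<N. W $$ (p, q) * R $$ (q, j))"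
      using that assms W(1) by (auto simp: scalar_prod_def)
    also have "\<dots> = (\<Sum>q = 0..<N. if q = p then W $$ (p, p) * R $$ (p, j) else 0)"
      using that W(2) by (intro sum.cong) auto
    finally show ?thesis using that by simp
  qed
  have "gram R W = transpose_mat R * (W * R)"
    unfolding gram_def by (rule assoc_mult_mat[of _ n N _ N _ n]) (use assms(1) W(1) in auto)
  then have "gram R W $$ (i, j) = (\<Sum>p = 0..<N. R $$ (p, i) * (W * R) $$ (p, j))"
    using assms W(1) by (auto simp: scalar_prod_def)
  also have "\<dots> = (\<Sum>p<N. W $$ (p, p) * R $$ (p, i) * R $$ (p, j))"
    using WR by (intro sum.cong) auto
  finally show ?thesis .
qed

text \<open>The row counts \<open>N\<close> and \<open>N'\<close> may differ: at the end a matrix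
  with \<open>2 * n\<close> rows is compared with its lower half.\<close>

lemma gram_eqI:
  assumes "R \<in> carrier_mat N n" "signature_mat N W" "R' \<in> carrier_mat N' n" "signature_mat N' W'"
    and "\<And>i j. i < n \<Longrightarrow> j < n \<Longrightarrow> (\<Sum>p<N. W $$ (p, p) * R $$ (p, i) * R $$ (p, j))
      = (\<Sum>p<N'. W' $$ (p, p) * R' $$ (p, i) * R' $$ (p, j))"
  shows "gram R W = gram R' W'"
proof (rule eq_matI)
  have c: "gram R W \<in> carrier_mat n n" "gram R' W' \<in> carrier_mat n n"
    using assms by (auto intro!: gram_carrier simp: signature_mat_def)
  show "dim_row (gram R W) = dim_row (gram R' W')" "dim_col (gram R W) = dim_col (gram R' W')"
    using c by auto
  fix i j assume "i < dim_row (gram R' W')" "j < dim_col (gram R' W')"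
  with c show "gram R W $$ (i, j) = gram R' W' $$ (i, j)"
    using gram_signature_index[OF assms(1,2)] gram_signature_index[OF assms(3,4)] assms(5) by auto
qed

lemma signature_mat_square:
  assumes "signature_mat N W"
  shows "W * W = 1\<^sub>m N"
proof (rule eq_matI)
  have W: "W \<in> carrier_mat N N" "\<And>p q. p < N \<Longrightarrow> q < N \<Longrightarrow> p \<noteq> q \<Longrightarrow> W $$ (p, q) = 0"
    "\<And>p. p < N \<Longrightarrow> W $$ (p, p) * W $$ (p, p) = 1"
    using assms by (auto simp: signature_mat_def diagonal_mat_def)
  show "dim_row (W * W) = dim_row (1\<^sub>m N)" "dim_col (W * W) = dim_col (1\<^sub>m N)"
    using W by auto
  fix i j assume "i < dim_row (1\<^sub>m N :: real mat)" "j < dim_col (1\<^sub>m N :: real mat)"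
  then have ij: "i < N" "j < N" by auto
  have "(W * W) $$ (i, j) = (\<Sum>q = 0..<N. W $$ (i, q) * W $$ (q, j))"
    using ij W(1) by (auto simp: scalar_prod_def)
  also have "\<dots> = (\<Sum>q = 0..<N. if q = i then W $$ (i, i) * W $$ (i, j) else 0)"
    using ij W(2) by (intro sum.cong) auto
  also have "\<dots> = (1\<^sub>m N) $$ (i, j)" using ij W(2,3) by auto
  finally show "(W * W) $$ (i, j) = (1\<^sub>m N) $$ (i, j)" .
qed

text \<open>If \<open>H W H\<^sup>T\<close> is a signature matrix then \<open>H\<close> has the left inverse \<open>W H\<^sup>T (H W H\<^sup>T)\<close>,
  so the congruence can be reversed.\<close>

lemma gram_mult_left:
  assumes H: "H \<in> carrier_mat N N" and R: "R \<in> carrier_mat N n" and "signature_mat N W"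
    and "signature_mat N (H * W * transpose_mat H)"
  shows "gram (H * R) (H * W * transpose_mat H) = gram R W"
proof -
  define V where "V = H * W * transpose_mat H"
  have W: "W \<in> carrier_mat N N" using assms by (auto simp: signature_mat_def)
  have HT: "transpose_mat H \<in> carrier_mat N N" using H by simp
  have V: "V \<in> carrier_mat N N" using H W by (auto simp: V_def)
  have WW: "W * W = 1\<^sub>m N" and VV: "V * V = 1\<^sub>m N"
    using signature_mat_square assms(3,4) by (auto simp: V_def)
  define Y where "Y = W * transpose_mat H"
  have Y: "Y \<in> carrier_mat N N" using W HT by (simp add: Y_def)
  have HY: "H * Y = V"
    unfolding V_def Y_def by (rule assoc_mult_mat[OF H W HT, symmetric])
  \<comment> \<open>\<open>H Y V = V V = 1\<close>, so \<open>Y V\<close> is a right inverse of the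
    square matrix \<open>H\<close> and therefore also a left inverse.\<close>
  have "H * (Y * V) = 1\<^sub>m N"
    using assoc_mult_mat[OF H Y V] HY VV by simp
  then have YVH: "Y * V * H = 1\<^sub>m N"
    using mat_mult_left_right_inverse[OF H, of "Y * V"] Y V by auto
  have VH: "V * H \<in> carrier_mat N N" and VHR: "V * (H * R) \<in> carrier_mat N n" using V H R by auto
  have HTVH: "transpose_mat H * (V * H) \<in> carrier_mat N N" using HT VH by simp
  have "Y * (V * H) = 1\<^sub>m N" using YVH assoc_mult_mat[OF Y V H] by simp
  then have "W * (transpose_mat H * (V * H)) = 1\<^sub>m N"
    using assoc_mult_mat[OF W HT VH] by (simp add: Y_def)
  \<comment> \<open>Multiplying by \<open>W\<close> once more cancels the leading \<open>W\<close>,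
    because \<open>W * W = 1\<close>.\<close>
  then have "W * (W * (transpose_mat H * (V * H))) = W"
    using W by simp
  then have key: "transpose_mat H * (V * H) = W"
    using assoc_mult_mat[OF W W HTVH] WW left_mult_one_mat[OF HTVH] by metis
  have "gram (H * R) V = transpose_mat (H * R) * (V * (H * R))"
    unfolding gram_def by (rule assoc_mult_mat[of _ n N _ N _ n]) (use H R V in auto)
  also have "\<dots> = transpose_mat R * (transpose_mat H * (V * (H * R)))"
    using assoc_mult_mat[OF _ HT VHR, of "transpose_mat R" n] R transpose_mult[OF H R] by simp
  also have "V * (H * R) = V * H * R"
    by (rule assoc_mult_mat[OF V H R, symmetric])
  also have "transpose_mat H * (V * H * R) = transpose_mat H * (V * H) * R"
    by (rule assoc_mult_mat[OF HT VH R, symmetric])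
  also have "transpose_mat R * (transpose_mat H * (V * H) * R) = gram R W"
    unfolding key gram_def using R W by (intro assoc_mult_mat[symmetric, of _ n N _ N _ n]) auto
  finally show ?thesis by (simp add: V_def)
qed

subsection \<open>A single zeroing step\<close>

lemma J2_carrier: "J2 \<in> carrier_mat 2 2"
  by (auto simp: J2_def mat_of_rows_list_def)

lemma giv_carrier: "giv x1 x2 = Some U \<Longrightarrow> U \<in> carrier_mat 2 2"
  by (auto simp: giv_def givens_mat_def J2_def mat_of_rows_list_def split: if_splits)

lemma hypf_carrier: "hypf x1 x2 = Some U \<Longrightarrow> U \<in> carrier_mat 2 2"
  by (auto simp: hypf_def hyperbolic_mat_def J2_def mat_of_rows_list_def split: if_splits)

lemma transform_rows_carrier:
  "M \<in> carrier_mat r c \<Longrightarrow> transform_rows U k m M \<in> carrier_mat r c"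
  by (simp add: transform_rows_def put_rows2_def)

lemma index_transform_rows:
  assumes "M \<in> carrier_mat r c" "U \<in> carrier_mat 2 2" "k - 1 < r" "m - 1 < r" "i < r" "j < c"
  shows "transform_rows U k m M $$ (i, j) =
    (if i = k - 1 then (J2 * U) $$ (0, 0) * M $$ (k - 1, j) + (J2 * U) $$ (0, 1) * M $$ (m - 1, j)
     else if i = m - 1 then (J2 * U) $$ (1, 0) * M $$ (k - 1, j) + (J2 * U) $$ (1, 1) * M $$ (m - 1, j)
     else M $$ (i, j))"
proof -
  have "(J2 * U * rows2 k m M) $$ (a, j)
      = (J2 * U) $$ (a, 0) * M $$ (k - 1, j) + (J2 * U) $$ (a, 1) * M $$ (m - 1, j)" if "a < 2" for a
  proof -
    have T: "J2 * U \<in> carrier_mat 2 2" using J2_carrier assms(2) by auto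
    have "rows2 k m M \<in> carrier_mat 2 c"
      using assms(1) by (auto simp: rows2_def)
    then have "(J2 * U * rows2 k m M) $$ (a, j)
        = (\<Sum>q<2. (J2 * U) $$ (a, q) * rows2 k m M $$ (q, j))"
      by (rule index_mult_mat_sum[OF T _ that assms(6)])
    also have "\<dots> = (J2 * U) $$ (a, 0) * M $$ (k - 1, j) + (J2 * U) $$ (a, 1) * M $$ (m - 1, j)"
      using assms by (simp add: numeral_2_eq_2 rows2_def mat_of_rows_index del: index_mult_mat(1))
    finally show ?thesis .
  qed
  with assms show ?thesis
    by (auto simp: transform_rows_def put_rows2_def simp del: index_mult_mat(1))
qed

lemma entry_transform_rows:
  assumes "M \<in> carrier_mat r c" "U \<in> carrier_mat 2 2" "k \<in> {1..r}" "m \<in> {1..r}" "i \<in> {1..r}" "j \<in> {1..c}"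
  shows "entry (transform_rows U k m M) i j =
    (if i = k then (J2 * U) $$ (0, 0) * entry M k j + (J2 * U) $$ (0, 1) * entry M m j
     else if i = m then (J2 * U) $$ (1, 0) * entry M k j + (J2 * U) $$ (1, 1) * entry M m j
     else entry M i j)"
proof -
  have "i - 1 = k - 1 \<longleftrightarrow> i = k" "i - 1 = m - 1 \<longleftrightarrow> i = m" using assms by auto
  moreover have "k - 1 < r" "m - 1 < r" "i - 1 < r" "j - 1 < c" using assms by auto
  ultimately show ?thesis
    using index_transform_rows[OF assms(1,2), of k m "i - 1" "j - 1"] by (simp only: entry_def)
qed

lemma J2_mult_entries:
  assumes "U \<in> carrier_mat 2 2"
  shows "(J2 * U) $$ (0, 0) = U $$ (1, 0)" "(J2 * U) $$ (0, 1) = U $$ (1, 1)"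
    "(J2 * U) $$ (1, 0) = U $$ (0, 0)" "(J2 * U) $$ (1, 1) = U $$ (0, 1)"
  using assms by (auto simp: J2_def mat_of_rows_list_def scalar_prod_def numeral_2_eq_2)

lemma J2_conj_entries:
  assumes "M \<in> carrier_mat 2 2" "a < 2" "b < 2"
  shows "(J2 * M * J2) $$ (a, b) = M $$ (1 - a, 1 - b)"
proof -
  have "a = 0 \<or> a = 1" "b = 0 \<or> b = 1" using assms by auto
  then show ?thesis
    using assms(1) by (auto simp: J2_def mat_of_rows_list_def scalar_prod_def numeral_2_eq_2)
qed

text \<open>\<open>giv\<close> sends the pair to a vector with second coordinate zero; the extra
  factor \<open>J2\<close> moves this zero to the first coordinate, that is, to row
  \<open>k\<close>. The first three equations say that \<open>T\<close> is orthogonal.\<close>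

lemma giv_rotation:
  assumes "giv x1 x2 = Some U"
  defines "T \<equiv> J2 * U"
  shows "(T $$ (0, 0))\<^sup>2 + (T $$ (1, 0))\<^sup>2 = 1" "(T $$ (0, 1))\<^sup>2 + (T $$ (1, 1))\<^sup>2 = 1"
    "T $$ (0, 0) * T $$ (0, 1) + T $$ (1, 0) * T $$ (1, 1) = 0"
    "T $$ (0, 0) * x1 + T $$ (0, 1) * x2 = 0"
proof -
  note U = giv_carrier[OF assms(1)]
  have pos: "1 + \<rho>\<^sup>2 > (0::real)" for \<rho> by (rule add_pos_nonneg) auto
  have "(T $$ (0, 0))\<^sup>2 + (T $$ (1, 0))\<^sup>2 = 1 \<and> (T $$ (0, 1))\<^sup>2 + (T $$ (1, 1))\<^sup>2 = 1 \<and>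
    T $$ (0, 0) * T $$ (0, 1) + T $$ (1, 0) * T $$ (1, 1) = 0 \<and>
    T $$ (0, 0) * x1 + T $$ (0, 1) * x2 = 0"
  proof (cases "\<bar>x1\<bar> \<ge> \<bar>x2\<bar>")
    case True
    define \<rho> where "\<rho> = x2 / x1"
    define c where "c = 1 / sqrt (1 + \<rho>\<^sup>2)"
    \<comment> \<open>The unit length of both columns reduces to this normalization.\<close>
    have c: "c\<^sup>2 * (1 + \<rho>\<^sup>2) = 1" using pos[of \<rho>] by (simp add: c_def power_divide)
    have "U = givens_mat \<rho>" "x1 \<noteq> 0" using assms(1) True by (auto simp: giv_def \<rho>_def split: if_splits)
    then have "T $$ (0, 0) = - c * \<rho>" "T $$ (0, 1) = c" "T $$ (1, 0) = c" "T $$ (1, 1) = c * \<rho>" "\<rho> * x1 = x2"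
      unfolding T_def J2_mult_entries[OF U]
      by (simp_all add: givens_mat_def mat_of_rows_list_def c_def \<rho>_def)
    with c show ?thesis by (auto simp: algebra_simps power2_eq_square)
  next
    case False
    define \<rho> where "\<rho> = x1 / x2"
    define c where "c = 1 / sqrt (1 + \<rho>\<^sup>2)"
    have c: "c\<^sup>2 * (1 + \<rho>\<^sup>2) = 1" using pos[of \<rho>] by (simp add: c_def power_divide)
    have "U = givens_mat \<rho> * J2" "x2 \<noteq> 0" using assms(1) False by (auto simp: giv_def \<rho>_def split: if_splits)
    then have "T $$ (0, 0) = c" "T $$ (0, 1) = - c * \<rho>" "T $$ (1, 0) = c * \<rho>" "T $$ (1, 1) = c" "\<rho> * x2 = x1"
      unfolding T_def J2_mult_entries[OF U]
      by (simp_all add: givens_mat_def mat_of_rows_list_def c_def \<rho>_def J2_def scalar_prod_def numeral_2_eq_2)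
    with c show ?thesis by (auto simp: algebra_simps power2_eq_square)
  qed
  then show "(T $$ (0, 0))\<^sup>2 + (T $$ (1, 0))\<^sup>2 = 1" "(T $$ (0, 1))\<^sup>2 + (T $$ (1, 1))\<^sup>2 = 1"
    "T $$ (0, 0) * T $$ (0, 1) + T $$ (1, 0) * T $$ (1, 1) = 0"
    "T $$ (0, 0) * x1 + T $$ (0, 1) * x2 = 0" by auto
qed

text \<open>With \<open>S = diag(1, -1)\<close> the first three equations say
  \<open>T^T S T = \<epsilon> S\<close>. If \<open>x1\<close> dominates, \<open>T\<close> is
  \<open>J2\<close> times a hyperbolic rotation, and this single interchange reverses the signature;
  otherwise the rotation stands between two factors \<open>J2\<close>, whose effects on the
  signature compensate.\<close>

lemma hypf_rotation:
  assumes "hypf x1 x2 = Some U"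
  defines "T \<equiv> J2 * U" and "\<epsilon> \<equiv> if \<bar>x1\<bar> > \<bar>x2\<bar> then - 1 else 1"
  shows "(T $$ (0, 0))\<^sup>2 - (T $$ (1, 0))\<^sup>2 = \<epsilon>" "(T $$ (0, 1))\<^sup>2 - (T $$ (1, 1))\<^sup>2 = - \<epsilon>"
    "T $$ (0, 0) * T $$ (0, 1) = T $$ (1, 0) * T $$ (1, 1)"
    "T $$ (0, 0) * x1 + T $$ (0, 1) * x2 = 0"
proof -
  note U = hypf_carrier[OF assms(1)]
  have pos: "1 - (y / x)\<^sup>2 > (0::real)" if "\<bar>y\<bar> < \<bar>x\<bar>" for x y
  proof -
    have "\<bar>y / x\<bar> < 1" using that by (simp add: divide_less_eq)
    then show ?thesis by (simp add: abs_square_less_1)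
  qed
  have "(T $$ (0, 0))\<^sup>2 - (T $$ (1, 0))\<^sup>2 = \<epsilon> \<and> (T $$ (0, 1))\<^sup>2 - (T $$ (1, 1))\<^sup>2 = - \<epsilon> \<and>
    T $$ (0, 0) * T $$ (0, 1) = T $$ (1, 0) * T $$ (1, 1) \<and>
    T $$ (0, 0) * x1 + T $$ (0, 1) * x2 = 0"
  proof (cases "\<bar>x1\<bar> > \<bar>x2\<bar>")
    case True
    define \<rho> where "\<rho> = x2 / x1"
    define c where "c = 1 / sqrt (1 - \<rho>\<^sup>2)"
    have c: "c\<^sup>2 * (1 - \<rho>\<^sup>2) = 1" using pos[OF True] by (simp add: c_def power_divide \<rho>_def[symmetric])
    have "U = hyperbolic_mat \<rho>" "x1 \<noteq> 0" using assms(1) True by (auto simp: hypf_def \<rho>_def split: if_splits)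
    then have "T $$ (0, 0) = - c * \<rho>" "T $$ (0, 1) = c" "T $$ (1, 0) = c" "T $$ (1, 1) = - c * \<rho>" "\<rho> * x1 = x2"
      unfolding T_def J2_mult_entries[OF U]
      by (simp_all add: hyperbolic_mat_def mat_of_rows_list_def c_def \<rho>_def)
    with c True show ?thesis by (auto simp: algebra_simps power2_eq_square \<epsilon>_def)
  next
    case False
    then have lt: "\<bar>x1\<bar> < \<bar>x2\<bar>" using assms(1) by (auto simp: hypf_def split: if_splits)
    define \<rho> where "\<rho> = x1 / x2"
    define c where "c = 1 / sqrt (1 - \<rho>\<^sup>2)"
    have c: "c\<^sup>2 * (1 - \<rho>\<^sup>2) = 1" using pos[OF lt] by (simp add: c_def power_divide \<rho>_def[symmetric])
    have "U = hyperbolic_mat \<rho> * J2" "x2 \<noteq> 0" using assms(1) lt by (auto simp: hypf_def \<rho>_def split: if_splits)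
    then have "T $$ (0, 0) = c" "T $$ (0, 1) = - c * \<rho>" "T $$ (1, 0) = - c * \<rho>" "T $$ (1, 1) = c" "\<rho> * x2 = x1"
      unfolding T_def J2_mult_entries[OF U]
      by (simp_all add: hyperbolic_mat_def mat_of_rows_list_def c_def \<rho>_def J2_def scalar_prod_def numeral_2_eq_2)
    with c lt show ?thesis by (auto simp: algebra_simps power2_eq_square \<epsilon>_def)
  qed
  then show "(T $$ (0, 0))\<^sup>2 - (T $$ (1, 0))\<^sup>2 = \<epsilon>" "(T $$ (0, 1))\<^sup>2 - (T $$ (1, 1))\<^sup>2 = - \<epsilon>"
    "T $$ (0, 0) * T $$ (0, 1) = T $$ (1, 0) * T $$ (1, 1)"
    "T $$ (0, 0) * x1 + T $$ (0, 1) * x2 = 0" by auto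
qed

text \<open>The three equations \<open>cong\<close> are, entry by entry, the congruence of the
  two-by-two signature blocks under the matrix with rows \<open>(a, b)\<close> and
  \<open>(c, d)\<close>. All other rows contribute the same to both sums.\<close>

lemma gram_two_rows:
  assumes R: "R \<in> carrier_mat N n" "signature_mat N W" and R': "R' \<in> carrier_mat N n" "signature_mat N W'"
    and k: "k < N" and m: "m < N" and "k \<noteq> m"
    and rows: "\<And>j. j < n \<Longrightarrow> R' $$ (k, j) = a * R $$ (k, j) + b * R $$ (m, j)"
      "\<And>j. j < n \<Longrightarrow> R' $$ (m, j) = c * R $$ (k, j) + d * R $$ (m, j)"
    and same: "\<And>i j. i < N \<Longrightarrow> j < n \<Longrightarrow> i \<noteq> k \<Longrightarrow> i \<noteq> m \<Longrightarrow> R' $$ (i, j) = R $$ (i, j)"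
      "\<And>i. i < N \<Longrightarrow> i \<noteq> k \<Longrightarrow> i \<noteq> m \<Longrightarrow> W' $$ (i, i) = W $$ (i, i)"
    and cong: "W' $$ (k, k) * a\<^sup>2 + W' $$ (m, m) * c\<^sup>2 = W $$ (k, k)"
      "W' $$ (k, k) * b\<^sup>2 + W' $$ (m, m) * d\<^sup>2 = W $$ (m, m)"
      "W' $$ (k, k) * (a * b) + W' $$ (m, m) * (c * d) = 0"
  shows "gram R' W' = gram R W"
proof (rule gram_eqI[OF R' R])
  fix i j assume ij: "i < n" "j < n"
  have split: "(\<Sum>p<N. f p) = f k + f m + (\<Sum>p\<in>{..<N} - {k, m}. f p)" for f :: "nat \<Rightarrow> real"
  proof -
    have "(\<Sum>p<N. f p) = (\<Sum>p\<in>{..<N} - {k, m}. f p) + (\<Sum>p\<in>{k, m}. f p)"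
      by (rule sum.subset_diff) (use k m in auto)
    with \<open>k \<noteq> m\<close> show ?thesis by simp
  qed
  let ?u = "W' $$ (k, k)" and ?v = "W' $$ (m, m)"
  let ?x = "R $$ (k, i)" and ?y = "R $$ (k, j)" and ?s = "R $$ (m, i)" and ?t = "R $$ (m, j)"
  \<comment> \<open>Collected by products of old entries, the coefficients are the left-hand sides
    of \<open>cong\<close>; the mixed products drop out.\<close>
  have "?u * (a * ?x + b * ?s) * (a * ?y + b * ?t) + ?v * (c * ?x + d * ?s) * (c * ?y + d * ?t)
    = (?u * a\<^sup>2 + ?v * c\<^sup>2) * (?x * ?y) + (?u * b\<^sup>2 + ?v * d\<^sup>2) * (?s * ?t)
      + (?u * (a * b) + ?v * (c * d)) * (?x * ?t + ?s * ?y)"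
    by (simp add: algebra_simps power2_eq_square)
  also have "\<dots> = W $$ (k, k) * ?x * ?y + W $$ (m, m) * ?s * ?t"
    unfolding cong by simp
  finally show "(\<Sum>p<N. W' $$ (p, p) * R' $$ (p, i) * R' $$ (p, j)) =
      (\<Sum>p<N. W $$ (p, p) * R $$ (p, i) * R $$ (p, j))"
    unfolding split using ij rows same by simp
qed

text \<open>Sign bookkeeping makes one call a congruence: equal signs call for an orthogonal matrix,
  opposite signs for a hyperbolic one, and the signs in \<open>W\<close> are interchanged exactly
  when the hyperbolic transformation reverses the signature.\<close>

lemma zeroing_cases:
  assumes z: "zeroing n j k (R, W) = Some (R', W')"
    and R: "R \<in> carrier_mat (2 * n) n" and W: "signature_mat (2 * n) W"
    and k: "k \<in> {1..n}" and j: "j \<in> {1..n}"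
  obtains U where "zeroing_U n R W k j = Some U" "R' = transform_rows U k (n + j) R"
    "U \<in> carrier_mat 2 2" "R' \<in> carrier_mat (2 * n) n" "signature_mat (2 * n) W'"
    "gram R' W' = gram R W" "entry R' k j = 0"
proof -
  define m where "m = n + j"
  from z obtain U where U: "zeroing_U n R W k j = Some U" "R' = transform_rows U k m R"
    and W': "W' = (if entry W k k \<noteq> entry W m m \<and> \<bar>entry R k j\<bar> > \<bar>entry R m j\<bar>
             then put_minor2 k m (J2 * minor2 k m W * J2) W else W)"
    by (auto simp: zeroing_def m_def)
  have Uc: "U \<in> carrier_mat 2 2"
    using U(1) giv_carrier hypf_carrier by (auto simp: zeroing_U_def split: if_splits)
  have R': "R' \<in> carrier_mat (2 * n) n" using R U(2) transform_rows_carrier by auto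
  define T where "T = J2 * U"
  let ?k = "k - 1" and ?m = "m - 1"
  have km: "?k < 2 * n" "?m < 2 * n" "?k \<noteq> ?m" using k j by (auto simp: m_def)
  have row': "R' $$ (i, c) =
      (if i = ?k then T $$ (0, 0) * R $$ (?k, c) + T $$ (0, 1) * R $$ (?m, c)
       else if i = ?m then T $$ (1, 0) * R $$ (?k, c) + T $$ (1, 1) * R $$ (?m, c)
       else R $$ (i, c))" if "i < 2 * n" "c < n" for i c
    unfolding U(2) T_def by (rule index_transform_rows[OF R Uc]) (use km that in auto)
  have Wd: "W \<in> carrier_mat (2 * n) (2 * n)" "\<And>p q. p < 2 * n \<Longrightarrow> q < 2 * n \<Longrightarrow> p \<noteq> q \<Longrightarrow> W $$ (p, q) = 0"
    "\<And>p. p < 2 * n \<Longrightarrow> W $$ (p, p) = 1 \<or> W $$ (p, p) = - 1"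
    using W by (auto simp: signature_mat_def diagonal_mat_def)
  \<comment> \<open>Conjugation by \<open>J2\<close> swaps the diagonal of the two-by-two minor,
    whose off-diagonal entries are zero.\<close>
  have W'_swap: "W' $$ (p, q) =
      (if p = ?k \<and> q = ?k then W $$ (?m, ?m) else if p = ?m \<and> q = ?m then W $$ (?k, ?k) else W $$ (p, q))"
    if "entry W k k \<noteq> entry W m m" "\<bar>entry R k j\<bar> > \<bar>entry R m j\<bar>" "p < 2 * n" "q < 2 * n" for p q
  proof -
    have M: "minor2 k m W \<in> carrier_mat 2 2"
      by (auto simp: minor2_def mat_of_rows_list_def)
    have "W' $$ (p, q) = (if p \<in> {?k, ?m} \<and> q \<in> {?k, ?m}
        then minor2 k m W $$ (if p = ?k then 1 else 0, if q = ?k then 1 else 0) else W $$ (p, q))"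
      using that Wd(1) by (simp add: W' put_minor2_def J2_conj_entries[OF M])
    then show ?thesis
      using that(3,4) km Wd(2) by (auto simp: minor2_def mat_of_rows_list_def entry_def)
  qed
  have W'_sig: "signature_mat (2 * n) W'"
  proof (cases "entry W k k \<noteq> entry W m m \<and> \<bar>entry R k j\<bar> > \<bar>entry R m j\<bar>")
    case True
    have "W' \<in> carrier_mat (2 * n) (2 * n)" using Wd(1) by (simp add: W' put_minor2_def)
    then show ?thesis
      using True W'_swap Wd km by (auto simp: signature_mat_def diagonal_mat_def)
  qed (use W W' in auto)
  have zero: "T $$ (0, 0) * entry R k j + T $$ (0, 1) * entry R m j = 0"
    using U(1) giv_rotation(4) hypf_rotation(4) by (auto simp: zeroing_U_def T_def m_def split: if_splits)
  have "gram R' W' = gram R W"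
  proof (rule gram_two_rows[OF R W R' W'_sig km])
    show "W' $$ (i, i) = W $$ (i, i)" if "i < 2 * n" "i \<noteq> ?k" "i \<noteq> ?m" for i
      using that W'_swap by (cases "entry W k k \<noteq> entry W m m \<and> \<bar>entry R k j\<bar> > \<bar>entry R m j\<bar>") (auto simp: W')
    have "W' $$ (?k, ?k) * (T $$ (0, 0))\<^sup>2 + W' $$ (?m, ?m) * (T $$ (1, 0))\<^sup>2 = W $$ (?k, ?k) \<and>
      W' $$ (?k, ?k) * (T $$ (0, 1))\<^sup>2 + W' $$ (?m, ?m) * (T $$ (1, 1))\<^sup>2 = W $$ (?m, ?m) \<and>
      W' $$ (?k, ?k) * (T $$ (0, 0) * T $$ (0, 1)) + W' $$ (?m, ?m) * (T $$ (1, 0) * T $$ (1, 1)) = 0"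
    proof (cases "entry W k k = entry W m m")
      case True
      then have "giv (entry R k j) (entry R m j) = Some U" using U(1) by (simp add: zeroing_U_def m_def)
      note rot = giv_rotation[OF this, folded T_def]
      have "W' = W" "W $$ (?m, ?m) = W $$ (?k, ?k)" using True by (simp_all add: W' entry_def)
      then show ?thesis
        using rot by (simp add: distrib_left[symmetric])
    next
      case False
      then have hyp: "hypf (entry R k j) (entry R m j) = Some U" using U(1) by (simp add: zeroing_U_def m_def)
      note rot = hypf_rotation[OF this, folded T_def]
      have opp: "W $$ (?m, ?m) = - W $$ (?k, ?k)" using Wd(3)[OF km(1)] Wd(3)[OF km(2)] False
        by (auto simp: entry_def)
      show ?thesis
      proof (cases "\<bar>entry R k j\<bar> > \<bar>entry R m j\<bar>")
        case True
        then have "W' $$ (?k, ?k) = - W $$ (?k, ?k)" "W' $$ (?m, ?m) = W $$ (?k, ?k)"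
          using W'_swap[OF False True] km opp by auto
        \<comment> \<open>The transformation negates the two-by-two signature
          (\<open>\<epsilon> = -1\<close>), and exchanging opposite signs negates it again.\<close>
        then show ?thesis using rot True opp by (simp add: right_diff_distrib[symmetric]) (auto simp: algebra_simps)
      next
        case F: False
        then have "W' = W" by (simp add: W')
        then show ?thesis using rot F opp by (simp add: right_diff_distrib[symmetric])
      qed
    qed
    then show "W' $$ (?k, ?k) * (T $$ (0, 0))\<^sup>2 + W' $$ (?m, ?m) * (T $$ (1, 0))\<^sup>2 = W $$ (?k, ?k)"
      "W' $$ (?k, ?k) * (T $$ (0, 1))\<^sup>2 + W' $$ (?m, ?m) * (T $$ (1, 1))\<^sup>2 = W $$ (?m, ?m)"
      "W' $$ (?k, ?k) * (T $$ (0, 0) * T $$ (0, 1)) + W' $$ (?m, ?m) * (T $$ (1, 0) * T $$ (1, 1)) = 0"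
      by auto
  qed (use km row' in auto)
  moreover have "entry R' k j = 0"
    using row'[of ?k "j - 1"] km j zero by (auto simp: entry_def)
  ultimately show ?thesis using that U Uc R' W'_sig by (simp add: m_def)
qed

subsection \<open>Generators and block transformations\<close>

lemma prod_range_carrier:
  "(\<And>i. a \<le> i \<Longrightarrow> i < b \<Longrightarrow> B i \<in> carrier_mat \<kappa> \<kappa>) \<Longrightarrow> prod_range \<kappa> B a b \<in> carrier_mat \<kappa> \<kappa>"
proof (induction "b - a" arbitrary: a)
  case 0
  then show ?case by (simp add: prod_range_def)
next
  case (Suc d)
  then have "prod_range \<kappa> B (Suc a) b \<in> carrier_mat \<kappa> \<kappa>" "B a \<in> carrier_mat \<kappa> \<kappa>" by simp_all
  moreover have "[a..<b] = a # [Suc a..<b]" using Suc.hyps(2) by (simp add: upt_conv_Cons)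
  ultimately show ?case by (simp add: prod_range_def)
qed

lemma prod_range_Suc: "a < b \<Longrightarrow> prod_range \<kappa> B a b = B a * prod_range \<kappa> B (Suc a) b"
  by (simp add: prod_range_def upt_conv_Cons)

lemma prod_range_mult:
  assumes "\<And>i. a \<le> i \<Longrightarrow> i < c \<Longrightarrow> B i \<in> carrier_mat \<kappa> \<kappa>" "a \<le> b" "b \<le> c"
  shows "prod_range \<kappa> B a b * prod_range \<kappa> B b c = prod_range \<kappa> B a c"
  using assms
proof (induction "b - a" arbitrary: a)
  case 0
  then have "prod_range \<kappa> B b c \<in> carrier_mat \<kappa> \<kappa>" by (intro prod_range_carrier) auto
  with 0 show ?case by (simp add: prod_range_def)
next
  case (Suc d)
  then have ab: "a < b" and IH: "prod_range \<kappa> B (Suc a) b * prod_range \<kappa> B b c = prod_range \<kappa> B (Suc a) c"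
    by simp_all
  have "B a \<in> carrier_mat \<kappa> \<kappa>" "prod_range \<kappa> B (Suc a) b \<in> carrier_mat \<kappa> \<kappa>" "prod_range \<kappa> B b c \<in> carrier_mat \<kappa> \<kappa>"
    using Suc.prems ab by (auto intro!: prod_range_carrier)
  then show ?case
    using ab Suc.prems(3) IH by (simp add: prod_range_Suc assoc_mult_mat[of _ \<kappa> \<kappa> _ \<kappa> _ \<kappa>])
qed

text \<open>Associativity in row form: a matrix is moved between the generator side and the vector
  \<open>v\<close>. Used for the transition matrices \<open>B\<close> and for
  \<open>G\<close>.\<close>

lemma row_mult_scalar_prod:
  fixes X :: "real mat"
  assumes "X \<in> carrier_mat r N" "M \<in> carrier_mat N c" "v \<in> carrier_vec c" "i < r"
  shows "row (X * M) i \<bullet> v = row X i \<bullet> (M *\<^sub>v v)"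
proof -
  have "row (X * M) i \<bullet> v = ((X * M) *\<^sub>v v) $ i"
    by (rule index_mult_mat_vec[symmetric]) (use assms in auto)
  also have "(X * M) *\<^sub>v v = X *\<^sub>v (M *\<^sub>v v)"
    by (rule assoc_mult_mat_vec[OF assms(1-3)])
  also have "\<dots> $ i = row X i \<bullet> (M *\<^sub>v v)"
    by (rule index_mult_mat_vec) (use assms in auto)
  finally show ?thesis .
qed

text \<open>The block \<open>H\<close> occupies the 1-based rows \<open>l\<close> to
  \<open>l + \<kappa>\<close>, that is, 0-based indices from \<open>l - 1\<close> on; outside this
  window \<open>Hh\<close> is the identity.\<close>

lemma entry_block_identity_mult:
  assumes H: "H \<in> carrier_mat (Suc \<kappa>) (Suc \<kappa>)" and R: "R \<in> carrier_mat N n"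
    and "1 \<le> l" "l + \<kappa> \<le> N"
  defines "Hh \<equiv> diag_block_mat [1\<^sub>m (l - 1), H, 1\<^sub>m (N - l - \<kappa>)]"
  shows "Hh \<in> carrier_mat N N"
    and "m \<le> \<kappa> \<Longrightarrow> j \<in> {1..n} \<Longrightarrow> entry (Hh * R) (l + m) j = (\<Sum>t\<le>\<kappa>. H $$ (m, t) * entry R (l + t) j)"
    and "r \<in> {1..N} \<Longrightarrow> r < l \<or> l + \<kappa> < r \<Longrightarrow> j \<in> {1..n} \<Longrightarrow> entry (Hh * R) r j = entry R r j"
proof -
  have Hd: "dim_row H = Suc \<kappa>" "dim_col H = Suc \<kappa>" using H by auto
  have N: "N = (l - 1) + (Suc \<kappa> + (N - l - \<kappa>))" using assms(3,4) by simp
  show Hh: "Hh \<in> carrier_mat N N"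
    using N by (auto simp: Hh_def Let_def Hd)
  have ind: "Hh $$ (p, q) = (if l - 1 \<le> p \<and> p < l + \<kappa> \<and> l - 1 \<le> q \<and> q < l + \<kappa>
      then H $$ (p - (l - 1), q - (l - 1)) else if p = q then 1 else 0)" if "p < N" "q < N" for p q
  proof -
    \<comment> \<open>\<open>diag_block_mat\<close> is unfolded one block at a time;
      \<open>E\<close> collects the two trailing blocks.\<close>
    define u where "u = N - l - \<kappa>"
    define E where "E = diag_block_mat [H, 1\<^sub>m u]"
    have Ed: "dim_row E = Suc \<kappa> + u" "dim_col E = Suc \<kappa> + u" by (simp_all add: E_def Let_def Hd)
    have last: "diag_block_mat [1\<^sub>m u] = (1\<^sub>m u :: real mat)"
      by (rule eq_matI) (auto simp: Let_def)
    have E: "E $$ (a, b) = (if a \<le> \<kappa> \<and> b \<le> \<kappa> then H $$ (a, b) else if a = b then 1 else 0)"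
      if "a < Suc \<kappa> + u" "b < Suc \<kappa> + u" for a b
    proof -
      have "E = four_block_mat H (0\<^sub>m (Suc \<kappa>) u) (0\<^sub>m u (Suc \<kappa>)) (1\<^sub>m u)"
        unfolding E_def diag_block_mat.simps(2)[of H] last by (simp add: Let_def Hd)
      then show ?thesis using that by (auto simp: Hd)
    qed
    have "Hh = four_block_mat (1\<^sub>m (l - 1)) (0\<^sub>m (l - 1) (Suc \<kappa> + u)) (0\<^sub>m (Suc \<kappa> + u) (l - 1)) E"
      unfolding Hh_def diag_block_mat.simps(2)[of "1\<^sub>m (l - 1)"] u_def[symmetric] E_def[symmetric]
      by (simp add: Let_def Ed)
    moreover have "p < (l - 1) + (Suc \<kappa> + u)" "q < (l - 1) + (Suc \<kappa> + u)"
      using that N u_def by auto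
    ultimately have F: "Hh $$ (p, q) = (if p < l - 1 then if q < l - 1 then if p = q then 1 else 0 else 0
        else if q < l - 1 then 0 else E $$ (p - (l - 1), q - (l - 1)))"
      by (simp add: Ed)
    have "p - (l - 1) < Suc \<kappa> + u" "q - (l - 1) < Suc \<kappa> + u" using that N u_def by auto
    note G = E[OF this]
    have iff: "l - 1 \<le> p \<Longrightarrow> p - (l - 1) \<le> \<kappa> \<longleftrightarrow> p < l + \<kappa>" "l - 1 \<le> q \<Longrightarrow> q - (l - 1) \<le> \<kappa> \<longleftrightarrow> q < l + \<kappa>"
      "l - 1 \<le> p \<Longrightarrow> l - 1 \<le> q \<Longrightarrow> p - (l - 1) = q - (l - 1) \<longleftrightarrow> p = q"
      using assms(3) by auto
    show ?thesis
    proof (cases "l - 1 \<le> p \<and> l - 1 \<le> q")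
      case True
      then show ?thesis unfolding F G using iff by (simp add: not_less[symmetric])
    next
      case False
      then show ?thesis unfolding F by auto
    qed
  qed
  have prod: "entry (Hh * R) r j = (\<Sum>q<N. Hh $$ (r - 1, q) * R $$ (q, j - 1))"
    if "r \<in> {1..N}" "j \<in> {1..n}" for r j
    unfolding entry_def by (rule index_mult_mat_sum[OF Hh R]) (use that in auto)
  show "entry (Hh * R) (l + m) j = (\<Sum>t\<le>\<kappa>. H $$ (m, t) * entry R (l + t) j)"
    if "m \<le> \<kappa>" "j \<in> {1..n}"
  proof -
    have "entry (Hh * R) (l + m) j = (\<Sum>q<N. Hh $$ (l + m - 1, q) * R $$ (q, j - 1))"
      using prod that assms(3,4) by auto
    \<comment> \<open>Row \<open>l + m\<close> of \<open>Hh\<close> is supported on the window, so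
      the sum may be restricted to it and then reindexed by \<open>t = q - (l - 1)\<close>.\<close>
    also have "\<dots> = (\<Sum>q\<in>{l - 1..<l + \<kappa>}. H $$ (m, q - (l - 1)) * R $$ (q, j - 1))"
      using that assms(3,4) by (intro sum.mono_neutral_cong_right) (auto simp: ind)
    also have "\<dots> = (\<Sum>t\<le>\<kappa>. H $$ (m, t) * entry R (l + t) j)"
      using assms(3) by (intro sum.reindex_bij_witness[of _ "\<lambda>t. l - 1 + t" "\<lambda>q. q - (l - 1)"])
        (auto simp: entry_def)
    finally show ?thesis .
  qed
  show "entry (Hh * R) r j = entry R r j" if "r \<in> {1..N}" "r < l \<or> l + \<kappa> < r" "j \<in> {1..n}"
  proof -
    have "entry (Hh * R) r j = (\<Sum>q<N. Hh $$ (r - 1, q) * R $$ (q, j - 1))"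
      using prod that by auto
    also have "\<dots> = (\<Sum>q<N. if q = r - 1 then R $$ (q, j - 1) else 0)"
      using that by (intro sum.cong) (auto simp: ind)
    also have "\<dots> = entry R r j" using that by (auto simp: entry_def)
    finally show ?thesis .
  qed
qed

subsection \<open>Invariants within a stage\<close>

text \<open>The invariant of steps 3 and 4 of stage \<open>l\<close> just before the call for row \<open>k\<close>. Row
  \<open>n + l\<close> picks up the support of the rows it has met, so as long as only rows up to \<open>l\<close>
  have been treated it vanishes from column \<open>k + \<kappa>\<close> on.\<close>

definition zeroing_inv ::
  "nat \<Rightarrow> nat \<Rightarrow> nat \<Rightarrow> real mat \<Rightarrow> real mat \<Rightarrow> nat \<Rightarrow> real mat \<times> real mat \<Rightarrow> bool" where
  "zeroing_inv n \<kappa> l K R0 k = (\<lambda>(R, W).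
     R \<in> carrier_mat (2 * n) n \<and> signature_mat (2 * n) W \<and> gram R W = K \<and>
     (\<forall>r\<in>{1..n}. \<forall>j\<in>{1..<l}. entry R r j = 0) \<and>
     (\<forall>j\<in>{1..<l}. entry R (n + l) j = 0) \<and>
     (\<forall>r\<in>{1..l}. \<forall>j\<in>{1..n}. r + \<kappa> < j \<longrightarrow> entry R r j = 0) \<and>
     (\<forall>r\<in>{1..<k}. entry R r l = 0) \<and>
     (k \<le> Suc l \<longrightarrow> (\<forall>j\<in>{1..n}. l < j \<and> k + \<kappa> \<le> j \<longrightarrow> entry R (n + l) j = 0)) \<and>
     (\<forall>r\<in>{k..2 * n}. \<forall>j\<in>{1..n}. r \<noteq> n + l \<longrightarrow> entry R r j = entry R0 r j))"

text \<open>Only rows \<open>k\<close> and \<open>n + l\<close> change, and both become combinations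
  of the two old ones, so a zero survives wherever both old rows vanish. The new zero in position
  \<open>(k, l)\<close> extends the treated range by one row.\<close>

lemma zeroing_inv_step:
  assumes inv: "zeroing_inv n \<kappa> l K R0 k RW" and z: "zeroing n l k RW = Some RW'"
    and k: "k \<in> {1..n}" "l \<le> k + \<kappa>" and l: "l \<in> {1..n}"
  shows "zeroing_inv n \<kappa> l K R0 (Suc k) RW'"
proof -
  obtain R W R' W' where RW: "RW = (R, W)" "RW' = (R', W')" by (cases RW, cases RW')
  note I = inv[unfolded zeroing_inv_def RW prod.case]
  have R: "R \<in> carrier_mat (2 * n) n" and W: "signature_mat (2 * n) W" using I by auto
  obtain U where U: "R' = transform_rows U k (n + l) R" "U \<in> carrier_mat 2 2"
    and R': "R' \<in> carrier_mat (2 * n) n" "signature_mat (2 * n) W'"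
    "gram R' W' = gram R W" "entry R' k l = 0"
    using zeroing_cases[OF z[unfolded RW] R W k(1) l] by metis
  define a b c d where "a = (J2 * U) $$ (0, 0)" "b = (J2 * U) $$ (0, 1)"
    "c = (J2 * U) $$ (1, 0)" "d = (J2 * U) $$ (1, 1)"
  have E: "entry R' r j =
    (if r = k then a * entry R k j + b * entry R (n + l) j
     else if r = n + l then c * entry R k j + d * entry R (n + l) j
     else entry R r j)" if "r \<in> {1..2 * n}" "j \<in> {1..n}" for r j
    unfolding U(1) a_b_c_d_def using entry_transform_rows[OF R U(2)] k l that by auto
  show ?thesis
    unfolding zeroing_inv_def RW prod.case
  proof (intro conjI ballI impI)
    show "R' \<in> carrier_mat (2 * n) n" "signature_mat (2 * n) W'" by fact+
    show "gram R' W' = K" using I R'(3) by simp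
    show "entry R' r j = 0" if "r \<in> {1..n}" "j \<in> {1..<l}" for r j
      using that E[of r j] I k l by auto
    show "entry R' (n + l) j = 0" if "j \<in> {1..<l}" for j
      using that E[of "n + l" j] I k l by auto
    show "entry R' r j = 0" if "r \<in> {1..l}" "j \<in> {1..n}" "r + \<kappa> < j" for r j
    proof (cases "r = k")
      case True
      \<comment> \<open>\<open>l \<le> k + \<kappa> < j\<close> places column \<open>j\<close> to
        the right of \<open>l\<close>, where row \<open>n + l\<close> is known to vanish.\<close>
      then have "entry R k j = 0" "entry R (n + l) j = 0" using that I k(2) by auto
      then show ?thesis using E[of r j] True that l by auto
    next
      case False
      then show ?thesis using E[of r j] that l I by auto
    qed
    show "entry R' r l = 0" if "r \<in> {1..<Suc k}" for r
    proof (cases "r = k")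
      case False
      then show ?thesis using that I E[of r l] k l by auto
    qed (use R'(4) in simp)
    show "entry R' (n + l) j = 0" if "Suc k \<le> Suc l" "j \<in> {1..n}" "l < j \<and> Suc k + \<kappa> \<le> j" for j
    proof -
      \<comment> \<open>Row \<open>k \<le> l\<close> ends at column \<open>k + \<kappa>\<close>, so
        mixing it into row \<open>n + l\<close> extends the support of the latter by at most one
        column.\<close>
      have "entry R k j = 0" "entry R (n + l) j = 0" using that I k by auto
      then show ?thesis using E[of "n + l" j] that l k by auto
    qed
    show "entry R' r j = entry R0 r j" if "r \<in> {Suc k..2 * n}" "j \<in> {1..n}" "r \<noteq> n + l" for r j
      using that E[of r j] I by auto
  qed
qed

text \<open>The rows of \<open>Y\<close> are generators of the entries of \<open>R\<close> to the right of column \<open>l + \<kappa>\<close>;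
  the parallel updates of \<open>R\<close> and \<open>Y\<close> are the same linear combinations of rows.\<close>

definition generator_inv ::
  "nat \<Rightarrow> nat \<Rightarrow> nat \<Rightarrow> (nat \<Rightarrow> real vec) \<Rightarrow> real mat \<Rightarrow> real mat \<Rightarrow> bool" where
  "generator_inv n \<kappa> l q R Y \<longleftrightarrow> Y \<in> carrier_mat (\<kappa> + 1) \<kappa> \<and>
     (\<forall>j\<in>{l + \<kappa> + 1..n}. (\<forall>m\<in>{1..\<kappa>}. entry R (l + m) j = row Y (m - 1) \<bullet> q j) \<and>
        entry R (n + l) j = row Y \<kappa> \<bullet> q j)"

text \<open>The relation is linear in the rows, so equal row combinations on both sides preserve it;
  the vectors \<open>q j\<close> enter only through their dimension.\<close>

lemma generator_inv_step:
  assumes R: "R \<in> carrier_mat (2 * n) n" and U: "U \<in> carrier_mat 2 2"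
    and inv: "generator_inv n \<kappa> l q R Y" and k: "k \<in> {l + 1..l + \<kappa>}" and l: "1 \<le> l" "l + \<kappa> + 1 \<le> n"
    and q: "\<And>j. j \<in> {l + \<kappa> + 1..n} \<Longrightarrow> q j \<in> carrier_vec \<kappa>"
  shows "generator_inv n \<kappa> l q (transform_rows U k (n + l) R) (transform_rows U (k - l) (\<kappa> + 1) Y)"
proof -
  define Y' where "Y' = transform_rows U (k - l) (\<kappa> + 1) Y"
  define R' where "R' = transform_rows U k (n + l) R"
  have Y: "Y \<in> carrier_mat (\<kappa> + 1) \<kappa>" using inv by (simp add: generator_inv_def)
  then have Y': "Y' \<in> carrier_mat (\<kappa> + 1) \<kappa>" unfolding Y'_def by (rule transform_rows_carrier)
  define a b c d where "a = (J2 * U) $$ (0, 0)" "b = (J2 * U) $$ (0, 1)"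
    "c = (J2 * U) $$ (1, 0)" "d = (J2 * U) $$ (1, 1)"
  \<comment> \<open>In 0-based numbering of \<open>Y\<close>, row \<open>k\<close> of
    \<open>R\<close> is matched with row \<open>k - l - 1\<close> and row \<open>n + l\<close> with
    row \<open>\<kappa>\<close>.\<close>
  have rowY: "row Y' i = (if i = k - l - 1 then a \<cdot>\<^sub>v row Y (k - l - 1) + b \<cdot>\<^sub>v row Y \<kappa>
      else if i = \<kappa> then c \<cdot>\<^sub>v row Y (k - l - 1) + d \<cdot>\<^sub>v row Y \<kappa> else row Y i)" if "i \<le> \<kappa>" for i
  proof (rule eq_vecI)
    fix t assume "t < dim_vec (if i = k - l - 1 then a \<cdot>\<^sub>v row Y (k - l - 1) + b \<cdot>\<^sub>v row Y \<kappa>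
      else if i = \<kappa> then c \<cdot>\<^sub>v row Y (k - l - 1) + d \<cdot>\<^sub>v row Y \<kappa> else row Y i)"
    then have t: "t < \<kappa>" using Y by (auto split: if_splits)
    have "Y' $$ (i, t) =
     (if i = k - l - 1 then a * Y $$ (k - l - 1, t) + b * Y $$ (\<kappa> + 1 - 1, t)
      else if i = \<kappa> + 1 - 1 then c * Y $$ (k - l - 1, t) + d * Y $$ (\<kappa> + 1 - 1, t)
      else Y $$ (i, t))"
      unfolding Y'_def a_b_c_d_def
      by (rule index_transform_rows[OF Y U]) (use k that t in auto)
    then show "row Y' i $ t = (if i = k - l - 1 then a \<cdot>\<^sub>v row Y (k - l - 1) + b \<cdot>\<^sub>v row Y \<kappa>
      else if i = \<kappa> then c \<cdot>\<^sub>v row Y (k - l - 1) + d \<cdot>\<^sub>v row Y \<kappa> else row Y i) $ t"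
      using Y Y' k that t by auto
  qed (use Y Y' k that in auto)
  have E: "entry R' r j =
    (if r = k then a * entry R k j + b * entry R (n + l) j
     else if r = n + l then c * entry R k j + d * entry R (n + l) j
     else entry R r j)" if "r \<in> {1..2 * n}" "j \<in> {1..n}" for r j
    unfolding R'_def a_b_c_d_def using entry_transform_rows[OF R U, of k "n + l" r j] k l that by auto
  have lin: "(x \<cdot>\<^sub>v row Y i + y \<cdot>\<^sub>v row Y i') \<bullet> q j = x * (row Y i \<bullet> q j) + y * (row Y i' \<bullet> q j)"
    if "i \<le> \<kappa>" "i' \<le> \<kappa>" "j \<in> {l + \<kappa> + 1..n}" for x y i i' j
  proof -
    have r: "row Y i \<in> carrier_vec \<kappa>" "row Y i' \<in> carrier_vec \<kappa>" using Y that by auto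
    have "(x \<cdot>\<^sub>v row Y i + y \<cdot>\<^sub>v row Y i') \<bullet> q j = (x \<cdot>\<^sub>v row Y i) \<bullet> q j + (y \<cdot>\<^sub>v row Y i') \<bullet> q j"
      by (rule add_scalar_prod_distrib) (use r q[OF that(3)] in auto)
    also have "\<dots> = x * (row Y i \<bullet> q j) + y * (row Y i' \<bullet> q j)"
      using r q[OF that(3)] by (simp del: row_carrier)
    finally show ?thesis .
  qed
  have kk: "entry R k j = row Y (k - l - 1) \<bullet> q j" and kl: "entry R (n + l) j = row Y \<kappa> \<bullet> q j"
    if "j \<in> {l + \<kappa> + 1..n}" for j
  proof -
    have "k - l \<in> {1..\<kappa>}" "l + (k - l) = k" using k by auto
    then show "entry R k j = row Y (k - l - 1) \<bullet> q j"
      using inv that unfolding generator_inv_def by metis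
    show "entry R (n + l) j = row Y \<kappa> \<bullet> q j" using inv that by (auto simp: generator_inv_def)
  qed
  have "generator_inv n \<kappa> l q R' Y'"
    unfolding generator_inv_def
  proof (intro conjI ballI)
    show "Y' \<in> carrier_mat (\<kappa> + 1) \<kappa>" by fact
    fix j assume j: "j \<in> {l + \<kappa> + 1..n}"
    have kd: "k - l - 1 \<noteq> \<kappa>" "k - l - 1 \<le> \<kappa>" using k by auto
    have "entry R' (n + l) j = c * entry R k j + d * entry R (n + l) j"
      using E[of "n + l" j] j k l by auto
    also have "\<dots> = (c \<cdot>\<^sub>v row Y (k - l - 1) + d \<cdot>\<^sub>v row Y \<kappa>) \<bullet> q j"
      unfolding kk[OF j] kl[OF j] by (rule lin[OF kd(2) _ j, symmetric]) simp
    also have "\<dots> = row Y' \<kappa> \<bullet> q j" using rowY[of \<kappa>] kd by simp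
    finally show "entry R' (n + l) j = row Y' \<kappa> \<bullet> q j" .
    show "entry R' (l + m) j = row Y' (m - 1) \<bullet> q j" if m: "m \<in> {1..\<kappa>}" for m
    proof (cases "l + m = k")
      case True
      then have mk: "m - 1 = k - l - 1" by auto
      have "entry R' (l + m) j = a * entry R k j + b * entry R (n + l) j"
        using E[of "l + m" j] True j k l by auto
      also have "\<dots> = (a \<cdot>\<^sub>v row Y (k - l - 1) + b \<cdot>\<^sub>v row Y \<kappa>) \<bullet> q j"
        unfolding kk[OF j] kl[OF j] by (rule lin[OF kd(2) _ j, symmetric]) simp
      also have "\<dots> = row Y' (m - 1) \<bullet> q j" unfolding mk using rowY[of "k - l - 1"] kd by simp
      finally show ?thesis .
    next
      case False
      then have "m - 1 \<noteq> k - l - 1" "m - 1 \<noteq> \<kappa>" "m - 1 \<le> \<kappa>" using m k by auto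
      then have "row Y' (m - 1) = row Y (m - 1)" using rowY[of "m - 1"] by simp
      moreover have "entry R' (l + m) j = entry R (l + m) j"
        using E[of "l + m" j] False j l m by auto
      moreover have "entry R (l + m) j = row Y (m - 1) \<bullet> q j"
        using inv j m unfolding generator_inv_def by blast
      ultimately show ?thesis by simp
    qed
  qed
  then show ?thesis by (simp add: R'_def Y'_def)
qed

section \<open>Split sums, stacked matrices and dimensions of plane products\<close>

lemma sum_lessThan_add: "(\<Sum>p<a + b. f p) = (\<Sum>p<a. f p) + (\<Sum>p<b. f (a + p))" for f :: "nat \<Rightarrow> real"
  by (induction b) (simp_all add: add.assoc)

lemma row_append_rows:
  assumes "A \<in> carrier_mat r1 c" "B \<in> carrier_mat r2 c" "i < r1 + r2"
  shows "row (A @\<^sub>r B) i = (if i < r1 then row A i else row B (i - r1))"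
  using assms by (intro eq_vecI) (auto simp: append_rows_def)

lemma entry_append_rows:
  assumes "A \<in> carrier_mat r1 c" "B \<in> carrier_mat r2 c" "i \<in> {1..r1 + r2}" "j \<in> {1..c}"
  shows "entry (A @\<^sub>r B) i j = (if i \<le> r1 then entry A i j else entry B (i - r1) j)"
proof -
  have "i - 1 < r1 \<longleftrightarrow> i \<le> r1" "i - 1 - r1 = i - r1 - 1" using assms(3) by auto
  then show ?thesis using assms by (auto simp: append_rows_def entry_def)
qed

lemma plane_product_carrier: "plane_product N H \<Longrightarrow> H \<in> carrier_mat N N"
  by (induction rule: plane_product.induct) (auto simp: put_minor2_def)

subsection \<open>Invariants between stages\<close>

text \<open>The state between two stages: \<open>LT\<close> is the initial upper block, \<open>a\<close> the initial diagonal
  of the lower block, and \<open>La\<close> the target of its rows.\<close>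

definition stage_inv ::
  "nat \<Rightarrow> nat \<Rightarrow> real mat \<Rightarrow> real mat \<Rightarrow> real \<Rightarrow> real mat \<Rightarrow> nat \<Rightarrow> real mat \<Rightarrow> real mat \<Rightarrow> bool" where
  "stage_inv n \<kappa> K LT a La l R W \<longleftrightarrow>
     R \<in> carrier_mat (2 * n) n \<and> signature_mat (2 * n) W \<and> gram R W = K \<and>
     (\<forall>r\<in>{1..n}. \<forall>j\<in>{1..l}. entry R r j = 0) \<and>
     (\<forall>r\<in>{1..l}. \<forall>j\<in>{1..n}. r + \<kappa> < j \<longrightarrow> entry R r j = 0) \<and>
     (\<forall>r\<in>{1..n}. \<forall>j\<in>{1..n}. l + \<kappa> < r \<longrightarrow> entry R r j = entry LT r j) \<and>
     (\<forall>i\<in>{Suc l..n}. \<forall>j\<in>{1..n}. entry R (n + i) j = (if i = j then a else 0)) \<and>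
     (\<forall>i\<in>{1..l}. \<forall>j\<in>{1..n}. entry R (n + i) j = entry La i j)"

text \<open>The state after step 2 of stage \<open>l\<close>.\<close>

definition half_stage_inv ::
  "nat \<Rightarrow> nat \<Rightarrow> real mat \<Rightarrow> real mat \<Rightarrow> real \<Rightarrow> real mat \<Rightarrow> nat \<Rightarrow> real mat \<Rightarrow> real mat \<Rightarrow> bool" where
  "half_stage_inv n \<kappa> K LT a La l R W \<longleftrightarrow>
     R \<in> carrier_mat (2 * n) n \<and> signature_mat (2 * n) W \<and> gram R W = K \<and>
     (\<forall>r\<in>{1..n}. \<forall>j\<in>{1..<l}. entry R r j = 0) \<and>
     (\<forall>r\<in>{1..l}. \<forall>j\<in>{1..n}. r + \<kappa> < j \<longrightarrow> entry R r j = 0) \<and>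
     (\<forall>r\<in>{1..n}. \<forall>j\<in>{1..n}. l + \<kappa> < r \<longrightarrow> entry R r j = entry LT r j) \<and>
     (\<forall>i\<in>{l..n}. \<forall>j\<in>{1..n}. entry R (n + i) j = (if i = j then a else 0)) \<and>
     (\<forall>i\<in>{1..<l}. \<forall>j\<in>{1..n}. entry R (n + i) j = entry La i j)"

text \<open>Starting at row \<open>max 1 (l - \<kappa>)\<close> skips no nonzero entry: an earlier
  row \<open>r\<close> satisfies \<open>r + \<kappa> < l\<close> and so already vanishes in column
  \<open>l\<close>. Row \<open>n + l\<close> is still \<open>a\<close> times the \<open>l\<close>-th
  unit row.\<close>

lemma zeroing_inv_start:
  assumes "half_stage_inv n \<kappa> K LT a La l R W" and l: "l \<in> {1..n}"
  shows "zeroing_inv n \<kappa> l K R (max 1 (l - \<kappa>)) (R, W)"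
  unfolding zeroing_inv_def prod.case
proof (intro conjI ballI impI)
  note I = assms(1)[unfolded half_stage_inv_def]
  show "R \<in> carrier_mat (2 * n) n" "signature_mat (2 * n) W" "gram R W = K" using I by auto
  show "entry R r j = 0" if "r \<in> {1..n}" "j \<in> {1..<l}" for r j using that I by blast
  show "entry R r j = 0" if "r \<in> {1..l}" "j \<in> {1..n}" "r + \<kappa> < j" for r j using that I by blast
  have row: "entry R (n + l) j = (if l = j then a else 0)" if "j \<in> {1..n}" for j
    using that I l by auto
  show "entry R (n + l) j = 0" if "j \<in> {1..<l}" for j using row[of j] that l by auto
  show "entry R (n + l) j = 0" if "j \<in> {1..n}" "l < j \<and> max 1 (l - \<kappa>) + \<kappa> \<le> j" for j
    using row[of j] that by auto
  show "entry R r l = 0" if "r \<in> {1..<max 1 (l - \<kappa>)}" for r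
  proof -
    have "r \<in> {1..l}" "r + \<kappa> < l" using that by auto
    then show ?thesis using I l by blast
  qed
qed auto

lemma zeroing_inv_iterate:
  assumes "iterate (zeroing n l) [a..<b] RW = Some RW'" and "zeroing_inv n \<kappa> l K R0 a RW"
    and "a \<le> b" "max 1 (l - \<kappa>) \<le> a" "b \<le> min n (l + \<kappa>) + 1" and l: "l \<in> {1..n}"
  shows "zeroing_inv n \<kappa> l K R0 b RW'"
proof (rule iterate_upt_invariant[OF assms(1), of "zeroing_inv n \<kappa> l K R0"])
  fix k st st' assume k: "a \<le> k" "k < b" and "zeroing_inv n \<kappa> l K R0 k st" "zeroing n l k st = Some st'"
  then show "zeroing_inv n \<kappa> l K R0 (Suc k) st'"
    using assms(4,5) by (intro zeroing_inv_step[OF _ _ _ _ l]) auto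
qed (use assms in auto)

text \<open>This is the part common to both kinds of stage; only the identification of row
  \<open>n + l\<close> is left to \<open>target\<close>. Column \<open>l\<close> is cleared by the
  calls down to row \<open>l + \<kappa>\<close>, and below by triangularity of the untouched rows of
  \<open>LT\<close>.\<close>

lemma stage_inv_finish:
  assumes half: "half_stage_inv n \<kappa> K LT a La l R W" and l: "l \<in> {1..n}"
    and fin: "zeroing_inv n \<kappa> l K R (min n (l + \<kappa>) + 1) (R', W')"
    and upper: "\<And>r. r \<in> {1..n} \<Longrightarrow> l < r \<Longrightarrow> entry LT r l = 0"
    and target: "\<And>j. j \<in> {1..n} \<Longrightarrow> entry R' (n + l) j = entry La l j"
  shows "stage_inv n \<kappa> K LT a La l R' W'"
  unfolding stage_inv_def
proof (intro conjI ballI impI)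
  note H = half[unfolded half_stage_inv_def]
  note F = fin[unfolded zeroing_inv_def prod.case]
  show "R' \<in> carrier_mat (2 * n) n" "signature_mat (2 * n) W'" "gram R' W' = K" using F by auto
  have same: "entry R' r j = entry R r j" if "r \<in> {min n (l + \<kappa>) + 1..2 * n}" "j \<in> {1..n}" "r \<noteq> n + l" for r j
    using that F by blast
  show low: "entry R' r j = entry LT r j" if "r \<in> {1..n}" "j \<in> {1..n}" "l + \<kappa> < r" for r j
  proof -
    have "r \<in> {min n (l + \<kappa>) + 1..2 * n}" "r \<noteq> n + l" using that l by auto
    then show ?thesis using same that H by auto
  qed
  show "entry R' r j = 0" if "r \<in> {1..n}" "j \<in> {1..l}" for r j
  proof (cases "j = l")
    case False
    then show ?thesis using that F by auto
  next
    case True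
    show ?thesis
    proof (cases "l + \<kappa> < r")
      case True
      then show ?thesis using low[of r j] upper[of r] \<open>j = l\<close> that l by auto
    next
      case False
      then have "r \<in> {1..<min n (l + \<kappa>) + 1}" using that by auto
      then show ?thesis using F \<open>j = l\<close> by blast
    qed
  qed
  show "entry R' r j = 0" if "r \<in> {1..l}" "j \<in> {1..n}" "r + \<kappa> < j" for r j
    using that F by blast
  show "entry R' (n + i) j = (if i = j then a else 0)" if "i \<in> {Suc l..n}" "j \<in> {1..n}" for i j
  proof -
    have "entry R' (n + i) j = entry R (n + i) j" using that l by (intro same) auto
    then show ?thesis using that H by auto
  qed
  show "entry R' (n + i) j = entry La i j" if "i \<in> {1..l}" "j \<in> {1..n}" for i j
  proof (cases "i = l")
    case False
    then have "entry R' (n + i) j = entry R (n + i) j" using that l by (intro same) auto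
    then show ?thesis using that False H by auto
  qed (use target that in auto)
qed

text \<open>Without columns beyond \<open>l + \<kappa>\<close> there is nothing for a QL step to
  remove from row \<open>l\<close>, so the state already has the required shape.\<close>

lemma half_stage_inv_tail:
  assumes inv: "stage_inv n \<kappa> K LT a La (l - 1) R W" and l: "l \<in> {1..n}" and "n \<le> l + \<kappa>"
  shows "half_stage_inv n \<kappa> K LT a La l R W"
proof -
  note I = inv[unfolded stage_inv_def]
  have e: "{1..l - 1} = {1..<l}" "Suc (l - 1) = l" using l by auto
  show ?thesis
    unfolding half_stage_inv_def
  proof (intro conjI ballI impI)
    show "R \<in> carrier_mat (2 * n) n" "signature_mat (2 * n) W" "gram R W = K" using I by auto
    show "entry R r j = 0" if "r \<in> {1..n}" "j \<in> {1..<l}" for r j using that I e by metis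
    show "entry R r j = 0" if "r \<in> {1..l}" "j \<in> {1..n}" "r + \<kappa> < j" for r j
    proof -
      \<comment> \<open>\<open>r + \<kappa> < j \<le> n \<le> l + \<kappa>\<close> excludes
        \<open>r = l\<close>.\<close>
      have "r \<in> {1..<l}" using that assms(3) by auto
      then show ?thesis using that I e by metis
    qed
    show "entry R r j = entry LT r j" if "r \<in> {1..n}" "j \<in> {1..n}" "l + \<kappa> < r" for r j
      using that assms(3) by auto
    show "entry R (n + i) j = (if i = j then a else 0)" if "i \<in> {l..n}" "j \<in> {1..n}" for i j
      using that I e by metis
    show "entry R (n + i) j = entry La i j" if "i \<in> {1..<l}" "j \<in> {1..n}" for i j
      using that I e by metis
  qed
qed

section \<open>The target matrix and the stages without a QL step\<close>

lemma entry_L_alpha_T: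
  assumes "i \<in> {1..n}" "j \<in> {1..n}"
  shows "entry (L_alpha_T n \<kappa> s z h B) i j =
    (if j < i then 0 else if j \<le> i + \<kappa> then s i $ (j - i)
     else z i \<bullet> (prod_range \<kappa> B (\<kappa> + i + 1) j *\<^sub>v h j))"
  using assms by (auto simp: L_alpha_T_def entry_def Let_def)

text \<open>Every column \<open>j \<ge> l\<close> falls into the band, so \<open>s l\<close> records
  row \<open>n + l\<close> completely and the generator branch of the target does not occur.\<close>

lemma tail_stage_inv:
  assumes st: "tail_stage n \<kappa> l R W R' W'" and inv: "stage_inv n \<kappa> K LT a (L_alpha_T n \<kappa> s z h B) (l - 1) R W"
    and l: "l \<in> {1..n}" and tail: "n \<le> l + \<kappa>"
    and upper: "\<And>r. r \<in> {1..n} \<Longrightarrow> l < r \<Longrightarrow> entry LT r l = 0"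
    and s: "s l = vec (min n (l + \<kappa>) + 1 - l) (\<lambda>t. entry R' (n + l) (l + t))"
  shows "stage_inv n \<kappa> K LT a (L_alpha_T n \<kappa> s z h B) l R' W'"
proof -
  obtain RW where it: "iterate (zeroing n l) [max 1 (l - \<kappa>)..<l + 1] (R, W) = Some RW"
    "iterate (zeroing n l) [l + 1..<min n (l + \<kappa>) + 1] RW = Some (R', W')"
    using st by (auto simp: tail_stage_def)
  note half = half_stage_inv_tail[OF inv l tail]
  have "zeroing_inv n \<kappa> l K R (l + 1) RW"
    by (rule zeroing_inv_iterate[OF it(1) zeroing_inv_start[OF half l]]) (use l in auto)
  then have fin: "zeroing_inv n \<kappa> l K R (min n (l + \<kappa>) + 1) (R', W')"
    by (rule zeroing_inv_iterate[OF it(2)]) (use l in auto)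
  show ?thesis
  proof (rule stage_inv_finish[OF half l fin upper])
    fix j assume j: "j \<in> {1..n}"
    show "entry R' (n + l) j = entry (L_alpha_T n \<kappa> s z h B) l j"
    proof (cases "j < l")
      case True
      then show ?thesis using fin j l by (simp add: entry_L_alpha_T zeroing_inv_def)
    next
      case False
      then have "j - l < min n (l + \<kappa>) + 1 - l" "l + (j - l) = j" using j tail by auto
      then show ?thesis using False j l s tail by (simp add: entry_L_alpha_T)
    qed
  qed auto
qed

section \<open>Stages with a QL step and parallel updates of generators\<close>

lemma zeroing_par_cases:
  assumes z: "zeroing_par n \<kappa> l k ((R, W), Y) = Some ((R', W'), Y')"
    and R: "R \<in> carrier_mat (2 * n) n" and W: "signature_mat (2 * n) W"
    and "k \<in> {1..n}" "l \<in> {1..n}"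
  obtains U where "zeroing n l k (R, W) = Some (R', W')" "U \<in> carrier_mat 2 2"
    "R' = transform_rows U k (n + l) R" "Y' = transform_rows U (k - l) (\<kappa> + 1) Y"
proof -
  from z obtain U where U: "zeroing n l k (R, W) = Some (R', W')" "zeroing_U n R W k l = Some U"
    "Y' = transform_rows U (k - l) (\<kappa> + 1) Y"
    by (auto simp: zeroing_par_def bind_eq_Some_conv)
  \<comment> \<open>Both updates use the value of the function \<open>zeroing_U\<close> at the same
    state, so \<open>U\<close> and \<open>U'\<close> coincide.\<close>
  from zeroing_cases[OF U(1) R W assms(4,5)] obtain U' where
    "zeroing_U n R W k l = Some U'" "R' = transform_rows U' k (n + l) R" "U' \<in> carrier_mat 2 2"
    by metis
  with U that show ?thesis by auto
qed

text \<open>The two invariants run together because the generator step takes the dimensions of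
  \<open>R\<close> and the signature property of \<open>W\<close> from
  \<open>zeroing_inv\<close>.\<close>

lemma zeroing_par_inv_iterate:
  assumes it: "iterate (zeroing_par n \<kappa> l) [l + 1..<l + \<kappa> + 1] ((R, W), Y) = Some ((R', W'), Y')"
    and zi: "zeroing_inv n \<kappa> l K R0 (l + 1) (R, W)" and gi: "generator_inv n \<kappa> l q R Y"
    and l: "1 \<le> l" "l + \<kappa> + 1 \<le> n"
    and q: "\<And>j. j \<in> {l + \<kappa> + 1..n} \<Longrightarrow> q j \<in> carrier_vec \<kappa>"
  shows "zeroing_inv n \<kappa> l K R0 (l + \<kappa> + 1) (R', W')" "generator_inv n \<kappa> l q R' Y'"
proof -
  define P where "P k st \<longleftrightarrow> zeroing_inv n \<kappa> l K R0 k (fst st) \<and> generator_inv n \<kappa> l q (fst (fst st)) (snd st)"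
    for k st
  have "P (l + \<kappa> + 1) ((R', W'), Y')"
  proof (rule iterate_upt_invariant[OF it, of P])
    show "P (l + 1) ((R, W), Y)" using zi gi by (simp add: P_def)
    fix k st st'
    assume k: "l + 1 \<le> k" "k < l + \<kappa> + 1" and P: "P k st" and step: "zeroing_par n \<kappa> l k st = Some st'"
    obtain R1 W1 Y1 R2 W2 Y2 where st: "st = ((R1, W1), Y1)" "st' = ((R2, W2), Y2)"
      by (metis surj_pair)
    have I: "zeroing_inv n \<kappa> l K R0 k (R1, W1)" "generator_inv n \<kappa> l q R1 Y1" using P by (simp_all add: P_def st)
    have R1: "R1 \<in> carrier_mat (2 * n) n" "signature_mat (2 * n) W1" using I(1) by (auto simp: zeroing_inv_def)
    have kl: "k \<in> {1..n}" "l \<in> {1..n}" "l \<le> k + \<kappa>" "k \<in> {l + 1..l + \<kappa>}" using k l by auto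
    obtain U where U: "zeroing n l k (R1, W1) = Some (R2, W2)" "U \<in> carrier_mat 2 2"
      "R2 = transform_rows U k (n + l) R1" "Y2 = transform_rows U (k - l) (\<kappa> + 1) Y1"
      using zeroing_par_cases[OF step[unfolded st] R1 kl(1,2)] by metis
    have "zeroing_inv n \<kappa> l K R0 (Suc k) (R2, W2)"
      by (rule zeroing_inv_step[OF I(1) U(1) kl(1,3,2)])
    moreover have "generator_inv n \<kappa> l q R2 Y2"
      unfolding U(3,4) by (rule generator_inv_step[OF R1(1) U(2) I(2) kl(4) l q])
    ultimately show "P (Suc k) st'" by (simp add: P_def st)
  qed simp
  then show "zeroing_inv n \<kappa> l K R0 (l + \<kappa> + 1) (R', W')" "generator_inv n \<kappa> l q R' Y'"
    by (simp_all add: P_def)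
qed

text \<open>\<open>Hh\<close> mixes only rows \<open>l\<close> to \<open>l + \<kappa>\<close>, all
  of which vanish left of column \<open>l\<close>, so the earlier zeros persist. The hypothesis
  \<open>row_l\<close> is the zero first row of the QL factorization, expressed for the tail of row
  \<open>l\<close>.\<close>

lemma half_stage_inv_full:
  assumes inv: "stage_inv n \<kappa> K LT a La (l - 1) R W" and l: "1 \<le> l" "l + \<kappa> + 1 \<le> n"
    and H: "H \<in> carrier_mat (\<kappa> + 1) (\<kappa> + 1)"
    and Hh: "Hh = diag_block_mat [1\<^sub>m (l - 1), H, 1\<^sub>m (2 * n - l - \<kappa>)]"
    and sig: "signature_mat (2 * n) (Hh * W * transpose_mat Hh)"
    and row_l: "\<And>j. j \<in> {l + \<kappa> + 1..n} \<Longrightarrow> (\<Sum>t\<le>\<kappa>. H $$ (0, t) * entry R (l + t) j) = 0"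
  shows "half_stage_inv n \<kappa> K LT a La l (Hh * R) (Hh * W * transpose_mat Hh)"
  unfolding half_stage_inv_def
proof (intro conjI ballI impI)
  note I = inv[unfolded stage_inv_def]
  have e: "{1..l - 1} = {1..<l}" "Suc (l - 1) = l" using l by auto
  have R: "R \<in> carrier_mat (2 * n) n" and W: "signature_mat (2 * n) W" using I by auto
  have H': "H \<in> carrier_mat (Suc \<kappa>) (Suc \<kappa>)" and l': "l + \<kappa> \<le> 2 * n" using H l by auto
  note blk = entry_block_identity_mult[OF H' R l(1) l', folded Hh]
  show "Hh * R \<in> carrier_mat (2 * n) n" using blk(1) R by simp
  show "signature_mat (2 * n) (Hh * W * transpose_mat Hh)" by fact
  show "gram (Hh * R) (Hh * W * transpose_mat Hh) = K"
    using gram_mult_left[OF blk(1) R W sig] I by simp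
  have block: "\<exists>m\<le>\<kappa>. r = l + m" if "\<not> (r < l \<or> l + \<kappa> < r)" for r
    using that by (intro exI[of _ "r - l"]) auto
  show "entry (Hh * R) r j = 0" if "r \<in> {1..n}" "j \<in> {1..<l}" for r j
  proof (cases "r < l \<or> l + \<kappa> < r")
    case True
    then have "entry (Hh * R) r j = entry R r j" using that l by (intro blk(3)) auto
    then show ?thesis using that I e by metis
  next
    case False
    then obtain m where "m \<le> \<kappa>" "r = l + m" using block by blast
    then have "entry (Hh * R) r j = (\<Sum>t\<le>\<kappa>. H $$ (m, t) * entry R (l + t) j)"
      using blk(2)[of m j] that l by auto
    also have "\<dots> = 0"
    proof (rule sum.neutral, intro ballI)
      fix t assume "t \<in> {..\<kappa>}"
      then have "l + t \<in> {1..n}" "j \<in> {1..l - 1}" using l that by auto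
      then have "entry R (l + t) j = 0" using I by blast
      then show "H $$ (m, t) * entry R (l + t) j = 0" by simp
    qed
    finally show ?thesis .
  qed
  show "entry (Hh * R) r j = 0" if "r \<in> {1..l}" "j \<in> {1..n}" "r + \<kappa> < j" for r j
  proof (cases "r = l")
    case True
    then show ?thesis using blk(2)[of 0 j] row_l[of j] that by auto
  next
    case False
    then have "entry (Hh * R) r j = entry R r j" "r \<in> {1..l - 1}" using that l by (auto intro!: blk(3))
    then show ?thesis using that I by metis
  qed
  show "entry (Hh * R) r j = entry LT r j" if "r \<in> {1..n}" "j \<in> {1..n}" "l + \<kappa> < r" for r j
  proof -
    \<comment> \<open>Row \<open>l + \<kappa>\<close> has now entered the window, so only rows
      strictly below it are known to agree with \<open>LT\<close>; the previous bound was
      \<open>l - 1 + \<kappa>\<close>.\<close>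
    have "entry (Hh * R) r j = entry R r j" "l - 1 + \<kappa> < r" using that l by (auto intro!: blk(3))
    then show ?thesis using that I by metis
  qed
  have lower: "entry (Hh * R) (n + i) j = entry R (n + i) j" if "i \<in> {1..n}" "j \<in> {1..n}" for i j
    using that l by (intro blk(3)) auto
  show "entry (Hh * R) (n + i) j = (if i = j then a else 0)" if "i \<in> {l..n}" "j \<in> {1..n}" for i j
  proof -
    have "entry (Hh * R) (n + i) j = entry R (n + i) j" using that l by (intro lower) auto
    then show ?thesis using that I e by metis
  qed
  show "entry (Hh * R) (n + i) j = entry La i j" if "i \<in> {1..<l}" "j \<in> {1..n}" for i j
  proof -
    have "entry (Hh * R) (n + i) j = entry R (n + i) j" using that l by (intro lower) auto
    then show ?thesis using that I e by metis
  qed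
qed

text \<open>\<open>gen\<close> and the last conclusion form a recursion: the window of rows and the
  first index of the products both move by one, so the lemma can be iterated over the stages. The
  row leaving the recursion is \<open>n + l\<close>, with generator \<open>z l\<close>.\<close>

lemma full_stage_inv:
  fixes q :: "nat \<Rightarrow> nat \<Rightarrow> real vec"
  assumes q_def: "q = (\<lambda>c j. prod_range \<kappa> B c j *\<^sub>v h j)"
    and st: "full_stage n \<kappa> g B l R W Xh R' W' Xh' (z l)"
    and inv: "stage_inv n \<kappa> K LT a (L_alpha_T n \<kappa> s z h B) (l - 1) R W"
    and l: "1 \<le> l" "l + \<kappa> + 1 \<le> n" and \<kappa>: "1 \<le> \<kappa>"
    and upper: "\<And>r. r \<in> {1..n} \<Longrightarrow> l < r \<Longrightarrow> entry LT r l = 0"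
    and qs: "upper_quasiseparable n \<kappa> LT g h B"
    and s: "s l = vec (min n (l + \<kappa>) + 1 - l) (\<lambda>t. entry R' (n + l) (l + t))"
    and Xh: "Xh \<in> carrier_mat \<kappa> \<kappa>"
    and gen: "\<And>m j. m < \<kappa> \<Longrightarrow> j \<in> {l + \<kappa>..n} \<Longrightarrow> entry R (l + m) j = row Xh m \<bullet> q (l + \<kappa>) j"
  shows "stage_inv n \<kappa> K LT a (L_alpha_T n \<kappa> s z h B) l R' W'" and "z l \<in> carrier_vec \<kappa>"
    and "Xh' \<in> carrier_mat \<kappa> \<kappa>"
    and "m < \<kappa> \<Longrightarrow> j \<in> {Suc l + \<kappa>..n} \<Longrightarrow> entry R' (Suc l + m) j = row Xh' m \<bullet> q (Suc l + \<kappa>) j"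
proof -
  obtain G H X Hh Wh RW Y where G: "G = (Xh * B (\<kappa> + l)) @\<^sub>r mat_of_row (g (\<kappa> + l))"
    and "plane_product (\<kappa> + 1) H" and X: "X \<in> carrier_mat \<kappa> \<kappa>"
    and HG: "H * G = mat_of_row (0\<^sub>v \<kappa>) @\<^sub>r X"
    and Hh: "Hh = diag_block_mat [1\<^sub>m (l - 1), H, 1\<^sub>m (2 * n - l - \<kappa>)]"
    and Wh: "Wh = Hh * W * transpose_mat Hh" "signature_mat (2 * n) Wh"
    and it: "iterate (zeroing n l) [max 1 (l - \<kappa>)..<l + 1] (Hh * R, Wh) = Some RW"
      "iterate (zeroing_par n \<kappa> l) [l + 1..<min n (l + \<kappa>) + 1]
          (RW, X @\<^sub>r mat_of_row (0\<^sub>v \<kappa>)) = Some ((R', W'), Y)"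
    and Xh': "Xh' = mat_of_rows \<kappa> (map (row Y) [0..<\<kappa>])" and zl: "z l = row Y \<kappa>"
    using st unfolding full_stage_def by blast
  have H: "H \<in> carrier_mat (\<kappa> + 1) (\<kappa> + 1)" by (rule plane_product_carrier) fact
  have Bc: "B i \<in> carrier_mat \<kappa> \<kappa>" if "2 \<le> i" "i < n" for i
    using qs that by (auto simp: upper_quasiseparable_def)
  have hc: "h j \<in> carrier_vec \<kappa>" if "2 \<le> j" "j \<le> n" for j
    using qs that by (auto simp: upper_quasiseparable_def)
  have gc: "g (\<kappa> + l) \<in> carrier_vec \<kappa>"
    using qs l \<kappa> by (auto simp: upper_quasiseparable_def)
  have qc: "q c j \<in> carrier_vec \<kappa>" if "2 \<le> c" "2 \<le> j" "j \<le> n" for c j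
  proof -
    have "prod_range \<kappa> B c j \<in> carrier_mat \<kappa> \<kappa>"
      using that Bc by (intro prod_range_carrier) auto
    then show ?thesis using hc that by (auto simp: q_def)
  qed
  \<comment> \<open>Peeling off \<open>B (l + \<kappa>)\<close> and absorbing it into
    \<open>Xh\<close> expresses the first \<open>\<kappa>\<close> rows by the same vectors
    \<open>q (Suc l + \<kappa>) j\<close> as the incoming generator
    \<open>g (\<kappa> + l)\<close>.\<close>
  have qB: "q (l + \<kappa>) j = B (l + \<kappa>) *\<^sub>v q (Suc l + \<kappa>) j" if "j \<in> {l + \<kappa> + 1..n}" for j
  proof -
    have "prod_range \<kappa> B (Suc (l + \<kappa>)) j \<in> carrier_mat \<kappa> \<kappa>"
      using that l \<kappa> Bc by (intro prod_range_carrier) auto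
    then show ?thesis
      using that l \<kappa> Bc[of "l + \<kappa>"] hc[of j] by (simp add: q_def prod_range_Suc assoc_mult_mat_vec[of _ \<kappa> \<kappa>])
  qed
  have XB: "Xh * B (\<kappa> + l) \<in> carrier_mat \<kappa> \<kappa>"
    using Xh Bc[of "\<kappa> + l"] l \<kappa> by auto
  have gm: "mat_of_row (g (\<kappa> + l)) \<in> carrier_mat 1 \<kappa>" using gc by simp
  have Gc: "G \<in> carrier_mat (\<kappa> + 1) \<kappa>" unfolding G by (rule carrier_append_rows[OF XB gm])
  have RG: "entry R (l + t) j = row G t \<bullet> q (Suc l + \<kappa>) j" if t: "t \<le> \<kappa>" and j: "j \<in> {l + \<kappa> + 1..n}" for t j
  proof (cases "t < \<kappa>")
    case True
    have "entry R (l + t) j = row Xh t \<bullet> (B (\<kappa> + l) *\<^sub>v q (Suc l + \<kappa>) j)"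
      using gen[OF True, of j] qB[OF j] j by (simp add: add.commute)
    also have "\<dots> = row (Xh * B (\<kappa> + l)) t \<bullet> q (Suc l + \<kappa>) j"
      by (rule row_mult_scalar_prod[OF Xh, symmetric]) (use Bc[of "\<kappa> + l"] l \<kappa> True j qc in auto)
    also have "row (Xh * B (\<kappa> + l)) t = row G t"
      unfolding G using row_append_rows[OF XB gm, of t] True by simp
    finally show ?thesis .
  next
    case False
    then have t: "t = \<kappa>" using t by simp
    \<comment> \<open>Row \<open>l + \<kappa>\<close> has not been touched by the first
      \<open>l - 1\<close> stages and still has its original generator.\<close>
    have "l + \<kappa> \<in> {1..n}" "j \<in> {1..n}" "l - 1 + \<kappa> < l + \<kappa>" using j l by auto
    then have "entry R (l + \<kappa>) j = entry LT (l + \<kappa>) j"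
      using inv unfolding stage_inv_def by blast
    also have "\<dots> = g (\<kappa> + l) \<bullet> q (Suc l + \<kappa>) j"
      using qs j l \<kappa> by (auto simp: upper_quasiseparable_def q_def add.commute)
    also have "g (\<kappa> + l) = row G \<kappa>"
      unfolding G using row_append_rows[OF XB gm, of \<kappa>] by simp
    finally show ?thesis using t by simp
  qed
  \<comment> \<open>Combining rows of \<open>R\<close> by \<open>H\<close> combines their generators
    by \<open>H\<close>, so the QL factorization of \<open>G\<close> can be read as a statement
    about \<open>R\<close>.\<close>
  have HGsum: "(\<Sum>t\<le>\<kappa>. H $$ (m, t) * entry R (l + t) j) = row (H * G) m \<bullet> q (Suc l + \<kappa>) j"
    if m: "m \<le> \<kappa>" and j: "j \<in> {l + \<kappa> + 1..n}" for m j
  proof -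
    have qj: "q (Suc l + \<kappa>) j \<in> carrier_vec \<kappa>" using j l \<kappa> by (intro qc) auto
    have "row (H * G) m \<bullet> q (Suc l + \<kappa>) j = row H m \<bullet> (G *\<^sub>v q (Suc l + \<kappa>) j)"
      by (rule row_mult_scalar_prod[OF H Gc qj]) (use m in simp)
    also have "\<dots> = (\<Sum>t<\<kappa> + 1. H $$ (m, t) * (row G t \<bullet> q (Suc l + \<kappa>) j))"
      unfolding scalar_prod_def[of "row H m"] using Gc H m by (intro sum.cong) auto
    also have "\<dots> = (\<Sum>t\<le>\<kappa>. H $$ (m, t) * entry R (l + t) j)"
      using RG[OF _ j] by (intro sum.cong) auto
    finally show ?thesis by simp
  qed
  have zm: "mat_of_row (0\<^sub>v \<kappa>) \<in> carrier_mat 1 \<kappa>" by simp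
  \<comment> \<open>The zero top row makes row \<open>l\<close> end at column
    \<open>l + \<kappa>\<close>; the rows of \<open>X\<close> become generators of the next
    \<open>\<kappa>\<close> rows.\<close>
  have rowHG: "row (H * G) m = (if m = 0 then 0\<^sub>v \<kappa> else row X (m - 1))" if "m \<le> \<kappa>" for m
    unfolding HG using row_append_rows[OF zm X, of m] that by auto
  have q0: "0\<^sub>v \<kappa> \<bullet> q (Suc l + \<kappa>) j = 0" if "j \<in> {l + \<kappa> + 1..n}" for j
    using qc[of "Suc l + \<kappa>" j] that \<kappa> l by simp
  have ln: "l \<in> {1..n}" using l by auto
  have mn: "min n (l + \<kappa>) = l + \<kappa>" using l by simp
  have half: "half_stage_inv n \<kappa> K LT a (L_alpha_T n \<kappa> s z h B) l (Hh * R) Wh"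
    unfolding Wh(1)
    by (rule half_stage_inv_full[OF inv l H Hh Wh(2)[unfolded Wh(1)]])
      (use HGsum[of 0] rowHG[of 0] q0 in auto)
  obtain R1 W1 where RW: "RW = (R1, W1)" by (cases RW)
  have zi: "zeroing_inv n \<kappa> l K (Hh * R) (l + 1) (R1, W1)"
    by (rule zeroing_inv_iterate[OF it(1)[unfolded RW] zeroing_inv_start[OF half ln]]) (use ln in auto)
  have R: "R \<in> carrier_mat (2 * n) n" using inv by (simp add: stage_inv_def)
  have H': "H \<in> carrier_mat (Suc \<kappa>) (Suc \<kappa>)" and l': "l + \<kappa> \<le> 2 * n" using H l by auto
  note blk = entry_block_identity_mult[OF H' R l(1) l', folded Hh]
  have YX: "row (X @\<^sub>r mat_of_row (0\<^sub>v \<kappa>)) i = (if i < \<kappa> then row X i else 0\<^sub>v \<kappa>)" if "i \<le> \<kappa>" for i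
    using row_append_rows[OF X zm, of i] that by auto
  have gi: "generator_inv n \<kappa> l (q (Suc l + \<kappa>)) R1 (X @\<^sub>r mat_of_row (0\<^sub>v \<kappa>))"
    unfolding generator_inv_def
  proof (intro conjI ballI)
    show "X @\<^sub>r mat_of_row (0\<^sub>v \<kappa>) \<in> carrier_mat (\<kappa> + 1) \<kappa>" by (rule carrier_append_rows[OF X zm])
    fix j assume j: "j \<in> {l + \<kappa> + 1..n}"
    \<comment> \<open>After step 3 row \<open>n + l\<close> still has no entry beyond column
      \<open>l + \<kappa>\<close>, which matches the zero last row of the matrix updated in
      parallel.\<close>
    have "entry R1 (n + l) j = 0" using zi j l by (auto simp: zeroing_inv_def)
    then show "entry R1 (n + l) j = row (X @\<^sub>r mat_of_row (0\<^sub>v \<kappa>)) \<kappa> \<bullet> q (Suc l + \<kappa>) j"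
      using YX[of \<kappa>] q0[OF j] by simp
    show "entry R1 (l + m) j = row (X @\<^sub>r mat_of_row (0\<^sub>v \<kappa>)) (m - 1) \<bullet> q (Suc l + \<kappa>) j"
      if m: "m \<in> {1..\<kappa>}" for m
    proof -
      have "l + m \<in> {l + 1..2 * n}" "j \<in> {1..n}" "l + m \<noteq> n + l" using m l j by auto
      \<comment> \<open>Step 3 stops at row \<open>l\<close>, so these rows are still those produced
        by \<open>Hh\<close>.\<close>
      then have "entry R1 (l + m) j = entry (Hh * R) (l + m) j"
        using zi unfolding zeroing_inv_def by blast
      also have "\<dots> = row (H * G) m \<bullet> q (Suc l + \<kappa>) j"
        using blk(2)[of m j] HGsum[of m j] m j by auto
      also have "row (H * G) m = row (X @\<^sub>r mat_of_row (0\<^sub>v \<kappa>)) (m - 1)"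
        using rowHG[of m] YX[of "m - 1"] m by auto
      finally show ?thesis .
    qed
  qed
  have it2: "iterate (zeroing_par n \<kappa> l) [l + 1..<l + \<kappa> + 1] ((R1, W1), X @\<^sub>r mat_of_row (0\<^sub>v \<kappa>))
      = Some ((R', W'), Y)"
    using it(2) unfolding mn RW .
  have qc': "q (Suc l + \<kappa>) j \<in> carrier_vec \<kappa>" if "j \<in> {l + \<kappa> + 1..n}" for j
    using that l \<kappa> by (intro qc) auto
  note fin = zeroing_par_inv_iterate[OF it2 zi gi l qc']
  have Y: "Y \<in> carrier_mat (\<kappa> + 1) \<kappa>" using fin(2) by (simp add: generator_inv_def)
  show "z l \<in> carrier_vec \<kappa>" unfolding zl by (rule row_carrier_vec[OF _ Y]) simp
  show "Xh' \<in> carrier_mat \<kappa> \<kappa>" unfolding Xh' using mat_of_rows_carrier(1)[of \<kappa> "map (row Y) [0..<\<kappa>]"] by simp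
  show "entry R' (Suc l + m) j = row Xh' m \<bullet> q (Suc l + \<kappa>) j" if "m < \<kappa>" "j \<in> {Suc l + \<kappa>..n}"
  proof -
    \<comment> \<open>Row \<open>Suc l + m\<close> is row \<open>l + Suc m\<close>, whose generator
      is the 0-based row \<open>m\<close> of \<open>Y\<close>: this is the shift of the
      window.\<close>
    have "Suc m \<in> {1..\<kappa>}" "j \<in> {l + \<kappa> + 1..n}" using that by auto
    then have "entry R' (l + Suc m) j = row Y (Suc m - 1) \<bullet> q (Suc l + \<kappa>) j"
      using fin(2) unfolding generator_inv_def by blast
    moreover have "row Xh' m = map (row Y) [0..<\<kappa>] ! m"
      unfolding Xh' by (rule mat_of_rows_row) (use that(1) row_carrier_vec[OF _ Y, of m] in simp_all)
    ultimately show ?thesis using that(1) by simp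
  qed
  show "stage_inv n \<kappa> K LT a (L_alpha_T n \<kappa> s z h B) l R' W'"
  proof (rule stage_inv_finish[OF half ln _ upper])
    show "zeroing_inv n \<kappa> l K (Hh * R) (min n (l + \<kappa>) + 1) (R', W')" using fin(1) mn by simp
    fix j assume j: "j \<in> {1..n}"
    consider "j < l" | "l \<le> j" "j \<le> l + \<kappa>" | "l + \<kappa> < j" by linarith
    then show "entry R' (n + l) j = entry (L_alpha_T n \<kappa> s z h B) l j"
    proof cases
      case 1
      then show ?thesis using fin(1) j ln by (simp add: entry_L_alpha_T zeroing_inv_def)
    next
      case 2
      then have "j - l < min n (l + \<kappa>) + 1 - l" "l + (j - l) = j" using j l by auto
      then show ?thesis using 2 j ln s by (simp add: entry_L_alpha_T)
    next
      case 3
      \<comment> \<open>Beyond the band the generator of row \<open>n + l\<close> is the last row of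
        \<open>Y\<close>, which is \<open>z l\<close>; the product starts at
        \<open>\<kappa> + l + 1\<close> as in the target.\<close>
      then have "entry R' (n + l) j = row Y \<kappa> \<bullet> q (Suc l + \<kappa>) j"
        using fin(2) j by (auto simp: generator_inv_def)
      then show ?thesis using 3 j ln zl by (simp add: entry_L_alpha_T q_def add.commute)
    qed
  qed auto
qed

subsection \<open>The initial state and the factorization\<close>

lemma signature_mat_diag_block:
  assumes "signature_mat n V" "signature_mat m D"
  shows "signature_mat (n + m) (diag_block_mat [V, D])"
    and "i < n \<Longrightarrow> diag_block_mat [V, D] $$ (i, i) = V $$ (i, i)"
    and "i < m \<Longrightarrow> diag_block_mat [V, D] $$ (n + i, n + i) = D $$ (i, i)"
proof -
  have V: "V \<in> carrier_mat n n" "\<And>p q. p < n \<Longrightarrow> q < n \<Longrightarrow> p \<noteq> q \<Longrightarrow> V $$ (p, q) = 0"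
    "\<And>p. p < n \<Longrightarrow> V $$ (p, p) \<in> {1, -1}"
    and D: "D \<in> carrier_mat m m" "\<And>p q. p < m \<Longrightarrow> q < m \<Longrightarrow> p \<noteq> q \<Longrightarrow> D $$ (p, q) = 0"
    "\<And>p. p < m \<Longrightarrow> D $$ (p, p) \<in> {1, -1}"
    using assms by (auto simp: signature_mat_def diagonal_mat_def)
  have "diag_block_mat [D] = D"
    using D(1) by (intro eq_matI) (auto simp: Let_def)
  then have block: "diag_block_mat [V, D] = four_block_mat V (0\<^sub>m n m) (0\<^sub>m m n) D"
    using V(1) D(1) by (simp add: diag_block_mat.simps(2)[of V] Let_def del: diag_block_mat.simps)
  define M where "M = diag_block_mat [V, D]"
  have M: "M \<in> carrier_mat (n + m) (n + m)"
    unfolding M_def block using V(1) D(1) by auto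
  have ind: "M $$ (p, q) =
      (if p < n then if q < n then V $$ (p, q) else 0 else if q < n then 0 else D $$ (p - n, q - n))"
    if "p < n + m" "q < n + m" for p q
    unfolding M_def block using that V(1) D(1) by auto
  have "signature_mat (n + m) M"
    unfolding signature_mat_def diagonal_mat_def
  proof (intro conjI allI impI)
    fix p q assume "p < dim_row M" "q < dim_col M" "p \<noteq> q"
    then have pq: "p < n + m" "q < n + m" "p \<noteq> q" using M by auto
    then show "M $$ (p, q) = 0"
      unfolding ind[OF pq(1,2)] using V(2)[of p q] D(2)[of "p - n" "q - n"] by auto
  next
    fix p assume p: "p < n + m"
    then show "M $$ (p, p) \<in> {1, -1}"
      unfolding ind[OF p p] using V(3)[of p] D(3)[of "p - n"] by auto
  qed (rule M)
  then show "signature_mat (n + m) (diag_block_mat [V, D])" by (simp only: M_def)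
  show "diag_block_mat [V, D] $$ (i, i) = V $$ (i, i)" if "i < n"
    using ind[of i i] that by (simp add: M_def del: diag_block_mat.simps)
  show "diag_block_mat [V, D] $$ (n + i, n + i) = D $$ (i, i)" if "i < m"
    using ind[of "n + i" "n + i"] that by (simp add: M_def del: diag_block_mat.simps)
qed

text \<open>The weighted inner product splits into the two halves; the lower one contributes
  \<open>\<alpha>\<close> on the diagonal, since its sign times the square of
  \<open>sqrt \<bar>\<alpha>\<bar>\<close> is \<open>\<alpha>\<close>.\<close>

lemma gram_stacked:
  assumes LT: "LT \<in> carrier_mat n n" and \<Omega>: "signature_mat n \<Omega>"
    and W_def: "W = diag_block_mat [\<Omega>, if \<alpha> \<ge> 0 then 1\<^sub>m n else - 1\<^sub>m n]"
  shows "signature_mat (2 * n) W"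
    and "gram (LT @\<^sub>r (sqrt \<bar>\<alpha>\<bar> \<cdot>\<^sub>m 1\<^sub>m n)) W = gram LT \<Omega> + \<alpha> \<cdot>\<^sub>m 1\<^sub>m n"
proof -
  define D :: "real mat" where "D = (if \<alpha> \<ge> 0 then 1\<^sub>m n else - 1\<^sub>m n)"
  have D: "signature_mat n D" by (auto simp: signature_mat_def diagonal_mat_def D_def)
  note blk = signature_mat_diag_block[OF \<Omega> D]
  have WD: "W = diag_block_mat [\<Omega>, D]" by (simp add: W_def D_def)
  show W: "signature_mat (2 * n) W" unfolding WD mult_2 by (rule blk(1))
  define S :: "real mat" where "S = sqrt \<bar>\<alpha>\<bar> \<cdot>\<^sub>m 1\<^sub>m n"
  have S: "S \<in> carrier_mat n n" by (simp add: S_def)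
  have R: "LT @\<^sub>r S \<in> carrier_mat (2 * n) n"
    unfolding mult_2 by (rule carrier_append_rows[OF LT S])
  have \<Omega>c: "\<Omega> \<in> carrier_mat n n" using \<Omega> by (simp add: signature_mat_def)
  have "gram (LT @\<^sub>r S) W = gram LT \<Omega> + \<alpha> \<cdot>\<^sub>m 1\<^sub>m n"
  proof (rule eq_matI)
    have c: "gram (LT @\<^sub>r S) W \<in> carrier_mat n n" "gram LT \<Omega> \<in> carrier_mat n n"
      using gram_carrier R LT W \<Omega>c by (auto simp: signature_mat_def)
    then show "dim_row (gram (LT @\<^sub>r S) W) = dim_row (gram LT \<Omega> + \<alpha> \<cdot>\<^sub>m 1\<^sub>m n)"
      "dim_col (gram (LT @\<^sub>r S) W) = dim_col (gram LT \<Omega> + \<alpha> \<cdot>\<^sub>m 1\<^sub>m n)" by auto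
    fix i j assume "i < dim_row (gram LT \<Omega> + \<alpha> \<cdot>\<^sub>m 1\<^sub>m n)" "j < dim_col (gram LT \<Omega> + \<alpha> \<cdot>\<^sub>m 1\<^sub>m n)"
    then have ij: "i < n" "j < n" by auto
    have top: "(LT @\<^sub>r S) $$ (p, t) = LT $$ (p, t)" if "p < n" "t < n" for p t
      using that LT S by (auto simp: append_rows_def)
    have bot: "(LT @\<^sub>r S) $$ (n + p, t) = (if p = t then sqrt \<bar>\<alpha>\<bar> else 0)" if "p < n" "t < n" for p t
      using that LT by (auto simp: append_rows_def S_def)
    have Dp: "D $$ (p, p) * (sqrt \<bar>\<alpha>\<bar> * sqrt \<bar>\<alpha>\<bar>) = \<alpha>" if "p < n" for p
      using that by (simp add: D_def)
    have "gram (LT @\<^sub>r S) W $$ (i, j)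
        = (\<Sum>p<n + n. W $$ (p, p) * (LT @\<^sub>r S) $$ (p, i) * (LT @\<^sub>r S) $$ (p, j))"
      using gram_signature_index[OF R W ij] by (simp add: mult_2)
    also have "\<dots> = (\<Sum>p<n. \<Omega> $$ (p, p) * LT $$ (p, i) * LT $$ (p, j))
        + (\<Sum>p<n. if p = i then if i = j then \<alpha> else 0 else 0)"
      unfolding sum_lessThan_add WD
      by (intro arg_cong2[of _ _ _ _ "(+)"] sum.cong) (use blk(2,3) top bot ij Dp in \<open>auto simp: mult.assoc\<close>)
    also have "\<dots> = (gram LT \<Omega> + \<alpha> \<cdot>\<^sub>m 1\<^sub>m n) $$ (i, j)"
      using gram_signature_index[OF LT \<Omega> ij] ij c(2) by simp
    finally show "gram (LT @\<^sub>r S) W $$ (i, j) = (gram LT \<Omega> + \<alpha> \<cdot>\<^sub>m 1\<^sub>m n) $$ (i, j)" .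
  qed
  then show "gram (LT @\<^sub>r (sqrt \<bar>\<alpha>\<bar> \<cdot>\<^sub>m 1\<^sub>m n)) W = gram LT \<Omega> + \<alpha> \<cdot>\<^sub>m 1\<^sub>m n"
    by (simp add: S_def)
qed

text \<open>At \<open>l = 0\<close> the conditions on treated columns and finished rows are void, so
  \<open>La\<close> is arbitrary here.\<close>

lemma stage_inv_0:
  assumes LT: "LT \<in> carrier_mat n n" and \<Omega>: "signature_mat n \<Omega>"
  shows "stage_inv n \<kappa> (gram LT \<Omega> + \<alpha> \<cdot>\<^sub>m 1\<^sub>m n) LT (sqrt \<bar>\<alpha>\<bar>) La 0
    (LT @\<^sub>r (sqrt \<bar>\<alpha>\<bar> \<cdot>\<^sub>m 1\<^sub>m n)) (diag_block_mat [\<Omega>, if \<alpha> \<ge> 0 then 1\<^sub>m n else - 1\<^sub>m n])"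
proof -
  have S: "sqrt \<bar>\<alpha>\<bar> \<cdot>\<^sub>m 1\<^sub>m n \<in> carrier_mat n n" by simp
  have "LT @\<^sub>r (sqrt \<bar>\<alpha>\<bar> \<cdot>\<^sub>m 1\<^sub>m n) \<in> carrier_mat (2 * n) n"
    unfolding mult_2 by (rule carrier_append_rows[OF LT S])
  moreover have "entry (LT @\<^sub>r (sqrt \<bar>\<alpha>\<bar> \<cdot>\<^sub>m 1\<^sub>m n)) i j =
      (if i \<le> n then entry LT i j else entry (sqrt \<bar>\<alpha>\<bar> \<cdot>\<^sub>m 1\<^sub>m n) (i - n) j)"
    if "i \<in> {1..n + n}" "j \<in> {1..n}" for i j
    by (rule entry_append_rows[OF LT S that])
  moreover have "entry (sqrt \<bar>\<alpha>\<bar> \<cdot>\<^sub>m 1\<^sub>m n) i j = (if i = j then sqrt \<bar>\<alpha>\<bar> else 0)"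
    if "i \<in> {1..n}" "j \<in> {1..n}" for i j
    using that by (auto simp: entry_def)
  ultimately show ?thesis
    using gram_stacked[OF LT \<Omega> refl] by (auto simp: stage_inv_def)
qed

text \<open>Splitting the product at \<open>\<kappa> + 1\<close> separates a factor depending only
  on the row, which is collected in \<open>Xh\<close>, from the vector shared by the first
  \<open>\<kappa>\<close> rows.\<close>

lemma initial_generators:
  assumes qs: "upper_quasiseparable n \<kappa> LT g h B" and "\<kappa> + 2 \<le> n" and m: "m < \<kappa>" and j: "j \<in> {\<kappa> + 1..n}"
    and Xh_def: "Xh = mat_of_rows \<kappa>
            (map (\<lambda>i. transpose_mat (prod_range \<kappa> B (i + 1) (\<kappa> + 1)) *\<^sub>v g i) [1..<\<kappa> + 1])"
  shows "entry LT (m + 1) j = row Xh m \<bullet> (prod_range \<kappa> B (\<kappa> + 1) j *\<^sub>v h j)"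
proof -
  define P where "P = prod_range \<kappa> B (m + 2) (\<kappa> + 1)"
  define v where "v = prod_range \<kappa> B (\<kappa> + 1) j *\<^sub>v h j"
  have Bc: "B i \<in> carrier_mat \<kappa> \<kappa>" if "2 \<le> i" "i < n" for i
    using qs that by (auto simp: upper_quasiseparable_def)
  have h: "h j \<in> carrier_vec \<kappa>" and g: "g (m + 1) \<in> carrier_vec \<kappa>"
    using qs j m assms(2) by (auto simp: upper_quasiseparable_def)
  have P: "P \<in> carrier_mat \<kappa> \<kappa>" and Q: "prod_range \<kappa> B (\<kappa> + 1) j \<in> carrier_mat \<kappa> \<kappa>"
    unfolding P_def using Bc j m assms(2) by (auto intro!: prod_range_carrier)
  have "P * prod_range \<kappa> B (\<kappa> + 1) j = prod_range \<kappa> B (m + 2) j"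
    unfolding P_def by (rule prod_range_mult) (use Bc j m in auto)
  then have "prod_range \<kappa> B (m + 2) j *\<^sub>v h j = P *\<^sub>v v"
    using assoc_mult_mat_vec[OF P Q h] by (simp add: v_def)
  moreover have "entry LT (m + 1) j = g (m + 1) \<bullet> (prod_range \<kappa> B (m + 2) j *\<^sub>v h j)"
    using qs j m by (auto simp: upper_quasiseparable_def)
  ultimately have "entry LT (m + 1) j = g (m + 1) \<bullet> (P *\<^sub>v v)" by simp
  \<comment> \<open>Generators are stored as column vectors, so \<open>P\<close> passes to the other
    side of the inner product as its transpose.\<close>
  also have "\<dots> = (transpose_mat P *\<^sub>v g (m + 1)) \<bullet> v"
    by (rule transpose_vec_mult_scalar[OF P _ g, symmetric]) (use Q h in \<open>auto simp: v_def\<close>)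
  also have "transpose_mat P *\<^sub>v g (m + 1) = row Xh m"
  proof -
    let ?f = "\<lambda>i. transpose_mat (prod_range \<kappa> B (i + 1) (\<kappa> + 1)) *\<^sub>v g i"
    have nth: "map ?f [1..<\<kappa> + 1] ! m = transpose_mat P *\<^sub>v g (m + 1)"
      using m nth_map_upt[of m "\<kappa> + 1" 1 ?f] by (simp add: P_def del: upt_Suc)
    have "row Xh m = map ?f [1..<\<kappa> + 1] ! m"
      unfolding Xh_def by (rule mat_of_rows_row) (use m P g nth in auto)
    then show ?thesis using nth by simp
  qed
  finally show ?thesis by (simp add: v_def)
qed

section \<open>Induction over the stages and the resulting factorization\<close>

theorem theorem1:
  fixes n \<kappa> :: nat
    and A L0 \<Omega>0 \<Omega>\<alpha> L\<alpha> :: "real mat"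
    and g h s z :: "nat \<Rightarrow> real vec"
    and B :: "nat \<Rightarrow> real mat"
    and \<alpha> :: real
  assumes "n \<ge> 1" and "\<kappa> \<ge> 1"
    and "A \<in> carrier_mat n n" and "transpose_mat A = A"
    and "L0 \<in> carrier_mat n n" and "lower_triangular L0"
    and "signature_mat n \<Omega>0"
    and "A = L0 * \<Omega>0 * transpose_mat L0"
    and "upper_quasiseparable n \<kappa> (transpose_mat L0) g h B"
    and "zeroing_scheme n \<kappa> L0 \<Omega>0 g B \<alpha> s z \<Omega>\<alpha>"
    and "L\<alpha> = transpose_mat (L_alpha_T n \<kappa> s z h B)"
  shows "(\<forall>i\<in>{1..n}. s i \<in> carrier_vec (min n (i + \<kappa>) + 1 - i))
       \<and> (\<forall>i\<in>{1..n - \<kappa> - 1}. z i \<in> carrier_vec \<kappa>)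
       \<and> signature_mat n \<Omega>\<alpha>
       \<and> A + \<alpha> \<cdot>\<^sub>m 1\<^sub>m n = L\<alpha> * \<Omega>\<alpha> * transpose_mat L\<alpha>"
proof -
  define LT where "LT = transpose_mat L0"
  define La where "La = L_alpha_T n \<kappa> s z h B"
  define K where "K = A + \<alpha> \<cdot>\<^sub>m 1\<^sub>m n"
  define q where "q = (\<lambda>c j. prod_range \<kappa> B c j *\<^sub>v h j)"
  have LT: "LT \<in> carrier_mat n n" using assms(5) by (simp add: LT_def)
  have qs: "upper_quasiseparable n \<kappa> LT g h B" using assms(9) by (simp add: LT_def)
  have A: "A = gram LT \<Omega>0" using assms(8) by (simp add: gram_def LT_def)
  have upper: "entry LT r l = 0" if "r \<in> {1..n}" "1 \<le> l" "l < r" for r l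
    using that assms(5,6) by (auto simp: LT_def entry_def lower_triangular_def)
  obtain R W Xh :: "nat \<Rightarrow> real mat" where R0: "R 0 = LT @\<^sub>r (sqrt \<bar>\<alpha>\<bar> \<cdot>\<^sub>m 1\<^sub>m n)"
    and W0: "W 0 = diag_block_mat [\<Omega>0, if \<alpha> \<ge> 0 then 1\<^sub>m n else - 1\<^sub>m n]"
    and Xh1: "n \<ge> \<kappa> + 2 \<Longrightarrow> Xh 1 = mat_of_rows \<kappa>
            (map (\<lambda>i. transpose_mat (prod_range \<kappa> B (i + 1) (\<kappa> + 1)) *\<^sub>v g i) [1..<\<kappa> + 1])"
    and step: "\<And>l. l \<in> {1..n} \<Longrightarrow>
          (if l + \<kappa> + 1 \<le> n
           then full_stage n \<kappa> g B l (R (l - 1)) (W (l - 1)) (Xh l) (R l) (W l) (Xh (l + 1)) (z l)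
           else tail_stage n \<kappa> l (R (l - 1)) (W (l - 1)) (R l) (W l))"
    and s: "\<And>l. l \<in> {1..n} \<Longrightarrow> s l = vec (min n (l + \<kappa>) + 1 - l) (\<lambda>t. entry (R l) (n + l) (l + t))"
    and \<Omega>\<alpha>: "\<Omega>\<alpha> = mat n n (\<lambda>(i, j). W n $$ (n + i, n + j))"
    using assms(10) unfolding zeroing_scheme_def LT_def by blast
  \<comment> \<open>The generator statement is carried only while another full stage follows, that
    is, for \<open>Suc l + \<kappa> + 1 \<le> n\<close>; it is what that stage consumes.\<close>
  have inv: "stage_inv n \<kappa> K LT (sqrt \<bar>\<alpha>\<bar>) La l (R l) (W l) \<and>
      (\<forall>i\<in>{1..l}. i + \<kappa> + 1 \<le> n \<longrightarrow> z i \<in> carrier_vec \<kappa>) \<and>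
      (l + \<kappa> + 2 \<le> n \<longrightarrow> Xh (Suc l) \<in> carrier_mat \<kappa> \<kappa> \<and>
        (\<forall>m<\<kappa>. \<forall>j\<in>{Suc l + \<kappa>..n}. entry (R l) (Suc l + m) j = row (Xh (Suc l)) m \<bullet> q (Suc l + \<kappa>) j))"
    if "l \<le> n" for l
    using that
  proof (induction l)
    case 0
    have gen: "entry (R 0) (Suc m) j = row (Xh 1) m \<bullet> q (Suc \<kappa>) j"
      if "\<kappa> + 2 \<le> n" "m < \<kappa>" "j \<in> {Suc \<kappa>..n}" for m j
    proof -
      have "entry (R 0) (Suc m) j = entry LT (m + 1) j"
        unfolding R0 using entry_append_rows[OF LT, of "sqrt \<bar>\<alpha>\<bar> \<cdot>\<^sub>m 1\<^sub>m n" n "Suc m" j] that by auto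
      also have "\<dots> = row (Xh 1) m \<bullet> q (Suc \<kappa>) j"
        using initial_generators[OF qs that(1,2) _ Xh1[OF that(1)], of j] that(3) by (simp add: q_def)
      finally show ?thesis .
    qed
    have "Xh 1 \<in> carrier_mat \<kappa> \<kappa>" if "\<kappa> + 2 \<le> n"
      unfolding Xh1[OF that] by (rule carrier_matI) auto
    moreover have "stage_inv n \<kappa> K LT (sqrt \<bar>\<alpha>\<bar>) La 0 (R 0) (W 0)"
      unfolding R0 W0 K_def A by (rule stage_inv_0[OF LT assms(7)])
    ultimately show ?case using gen by auto
  next
    case (Suc l)
    then have l: "Suc l \<in> {1..n}" and IH: "stage_inv n \<kappa> K LT (sqrt \<bar>\<alpha>\<bar>) (L_alpha_T n \<kappa> s z h B) (Suc l - 1) (R l) (W l)"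
      by (simp_all add: La_def)
    have up: "entry LT r (Suc l) = 0" if "r \<in> {1..n}" "Suc l < r" for r using upper that by simp
    show ?case
    proof (cases "Suc l + \<kappa> + 1 \<le> n")
      case True
      have st: "full_stage n \<kappa> g B (Suc l) (R l) (W l) (Xh (Suc l)) (R (Suc l)) (W (Suc l))
          (Xh (Suc (Suc l))) (z (Suc l))"
        using step[OF l] True by simp
      have Xh: "Xh (Suc l) \<in> carrier_mat \<kappa> \<kappa>"
        and gen: "\<And>m j. m < \<kappa> \<Longrightarrow> j \<in> {Suc l + \<kappa>..n} \<Longrightarrow>
          entry (R l) (Suc l + m) j = row (Xh (Suc l)) m \<bullet> q (Suc l + \<kappa>) j"
        using Suc True by auto
      note fs = full_stage_inv[OF q_def st IH _ True assms(2) up qs s[OF l] Xh gen]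
      have "z i \<in> carrier_vec \<kappa>" if "i \<in> {1..Suc l}" "i + \<kappa> + 1 \<le> n" for i
      proof (cases "i = Suc l")
        case False
        then show ?thesis using Suc that by auto
      qed (use fs(2) in simp)
      then show ?thesis using fs(1,3,4) unfolding La_def by simp
    next
      case False
      have st: "tail_stage n \<kappa> (Suc l) (R l) (W l) (R (Suc l)) (W (Suc l))"
        using step[OF l] False by simp
      have "stage_inv n \<kappa> K LT (sqrt \<bar>\<alpha>\<bar>) La (Suc l) (R (Suc l)) (W (Suc l))"
        unfolding La_def by (rule tail_stage_inv[OF st IH l _ up s[OF l]]) (use False in auto)
      \<comment> \<open>The index \<open>Suc l\<close> is excluded by \<open>False\<close>: a tail
        stage produces no \<open>z\<close>.\<close>
      moreover have "z i \<in> carrier_vec \<kappa>" if "i \<in> {1..Suc l}" "i + \<kappa> + 1 \<le> n" for i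
        using Suc that False by (cases "i = Suc l") auto
      ultimately show ?thesis using False by simp
    qed
  qed
  note fin = inv[OF order_refl, THEN conjunct1, unfolded stage_inv_def]
  have Rn: "R n \<in> carrier_mat (2 * n) n" and Wn: "signature_mat (2 * n) (W n)" and Kn: "gram (R n) (W n) = K"
    using fin by auto
  have sig: "signature_mat n \<Omega>\<alpha>"
    using Wn by (auto simp: \<Omega>\<alpha> signature_mat_def diagonal_mat_def)
  have La: "La \<in> carrier_mat n n" by (simp add: La_def L_alpha_T_def)
  \<comment> \<open>The upper half of the final \<open>R n\<close> is zero, so the sum over
    \<open>2 * n\<close> rows reduces to the lower half, which is \<open>La\<close>.\<close>
  have "K = gram La \<Omega>\<alpha>"
    unfolding Kn[symmetric]
  proof (rule gram_eqI[OF Rn Wn La sig])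
    fix i j assume ij: "i < n" "j < n"
    have top: "R n $$ (p, t) = 0" if "p < n" "t < n" for p t
    proof -
      have "entry (R n) (Suc p) (Suc t) = 0" using fin that by auto
      then show ?thesis by (simp add: entry_def)
    qed
    have bot: "R n $$ (n + p, t) = La $$ (p, t)" if "p < n" "t < n" for p t
    proof -
      have "Suc p \<in> {1..n}" "Suc t \<in> {1..n}" using that by auto
      then have "entry (R n) (n + Suc p) (Suc t) = entry La (Suc p) (Suc t)" using fin by blast
      then show ?thesis by (simp add: entry_def)
    qed
    show "(\<Sum>p<2 * n. W n $$ (p, p) * R n $$ (p, i) * R n $$ (p, j)) =
        (\<Sum>p<n. \<Omega>\<alpha> $$ (p, p) * La $$ (p, i) * La $$ (p, j))"
      unfolding mult_2 sum_lessThan_add using top bot ij by (simp add: \<Omega>\<alpha>)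
  qed
  then have "A + \<alpha> \<cdot>\<^sub>m 1\<^sub>m n = L\<alpha> * \<Omega>\<alpha> * transpose_mat L\<alpha>"
    by (simp add: K_def gram_def assms(11) La_def)
  moreover have "\<forall>i\<in>{1..n}. s i \<in> carrier_vec (min n (i + \<kappa>) + 1 - i)"
    using s by simp
  moreover have "\<forall>i\<in>{1..n - \<kappa> - 1}. z i \<in> carrier_vec \<kappa>"
    using inv[of n] by auto
  ultimately show ?thesis using sig by blast
qed

end
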